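(* There is an algorithm that, given a DFA $M$ with $n$ states over an alphabet $\Sigma$, decides in $O(n^3)$ time whether $L = L(M)$ is almost prefix-convex; likewise for almost suffix-convex, almost factor-convex, and almost subword-convex.
   Context: Let $\unlhd$ be one of the relations on $\Sigma^*$: prefix ($v \unlhd w$ iff $w = vx$ for some $x$), suffix ($w = xv$), factor ($w = xvy$), or subword ($v$ is a not-necessarily-contiguous subsequence of $w$). A witness to the failure of $\unlhd$-convexity of $L$ is a triple $(u,v,w)$ of words with $u, w \in L$, $v \notin L$, $u \unlhd v$ and $v \unlhd w$. $L$ is $\unlhd$-convex if no such witness exists. $L$ is almost $\unlhd$-convex if there exists at least one, but only finitely many, such witnesses. The alphabet $\Sigma$ is regarded as fixed in the running-time bound. *)

theory Defs
  imports Complex_Main "HOL-Library.Sublist" "HOL-Library.Landau_Symbols"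
begin

section \<open>Almost convex languages\<close>

text \<open>The four orders on words are the library relations \<open>prefix\<close>, \<open>suffix\<close>,
  \<open>sublist\<close> (contiguous factor) and \<open>subseq\<close> (scattered subword).\<close>

definition convexity_witnesses ::
  "'a set \<Rightarrow> ('a list \<Rightarrow> 'a list \<Rightarrow> bool) \<Rightarrow> 'a list set \<Rightarrow> ('a list \<times> 'a list \<times> 'a list) set" where
  "convexity_witnesses \<Sigma> R L =
     {(u, v, w). u \<in> L \<and> w \<in> L \<and> v \<in> lists \<Sigma> \<and> v \<notin> L \<and> R u v \<and> R v w}"

definition almost_convex :: "'a set \<Rightarrow> ('a list \<Rightarrow> 'a list \<Rightarrow> bool) \<Rightarrow> 'a list set \<Rightarrow> bool" where
  "almost_convex \<Sigma> R L \<longleftrightarrow>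
     convexity_witnesses \<Sigma> R L \<noteq> {} \<and> finite (convexity_witnesses \<Sigma> R L)"

section \<open>Deterministic finite automata\<close>

record ('q, 'a) dfa =
  states :: "'q set"
  alphabet :: "'a set"
  initial :: 'q
  final :: "'q set"
  delta :: "'q \<Rightarrow> 'a \<Rightarrow> 'q"

definition is_dfa :: "('q, 'a) dfa \<Rightarrow> bool" where
  "is_dfa M \<longleftrightarrow> finite (states M) \<and> finite (alphabet M) \<and> initial M \<in> states M \<and>
     final M \<subseteq> states M \<and> (\<forall>q \<in> states M. \<forall>a \<in> alphabet M. delta M q a \<in> states M)"

definition lang :: "('q, 'a) dfa \<Rightarrow> 'a list set" where
  "lang M = {w \<in> lists (alphabet M). foldl (delta M) (initial M) w \<in> final M}"

section \<open>Random access machines with uniform cost\<close>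

text \<open>Structured programs for a random access machine: the work memory is an unbounded array of
  natural numbers, the input is a read-only random access array, and the arithmetic operations are
  addition and truncated subtraction only. Every operation (constant, input access, memory access,
  addition, subtraction, assignment, branching on a value being nonzero) costs one time unit.\<close>

type_synonym memory = "nat \<Rightarrow> nat"

datatype ram_exp =
    Const nat
  | Input ram_exp
  | Mem ram_exp
  | Add ram_exp ram_exp
  | Sub ram_exp ram_exp

datatype ram_prog =
    Skip
  | Assign ram_exp ram_exp  \<comment> \<open>address, value\<close>
  | Seq ram_prog ram_prog
  | Cond ram_exp ram_prog ram_prog
  | While ram_exp ram_prog

primrec exp_val :: "nat list \<Rightarrow> memory \<Rightarrow> ram_exp \<Rightarrow> nat" where
  "exp_val x m (Const c) = c"
| "exp_val x m (Input e) = (if exp_val x m e < length x then x ! exp_val x m e else 0)"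
| "exp_val x m (Mem e) = m (exp_val x m e)"
| "exp_val x m (Add e f) = exp_val x m e + exp_val x m f"
| "exp_val x m (Sub e f) = exp_val x m e - exp_val x m f"

primrec exp_cost :: "ram_exp \<Rightarrow> nat" where
  "exp_cost (Const c) = 1"
| "exp_cost (Input e) = exp_cost e + 1"
| "exp_cost (Mem e) = exp_cost e + 1"
| "exp_cost (Add e f) = exp_cost e + exp_cost f + 1"
| "exp_cost (Sub e f) = exp_cost e + exp_cost f + 1"

text \<open>\<open>exec x P m t m'\<close>: on input \<open>x\<close>, program \<open>P\<close> started in memory \<open>m\<close> halts in memory \<open>m'\<close>
  after exactly \<open>t\<close> time units.\<close>

inductive exec :: "nat list \<Rightarrow> ram_prog \<Rightarrow> memory \<Rightarrow> nat \<Rightarrow> memory \<Rightarrow> bool" for x :: "nat list" where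
  exec_Skip: "exec x Skip m 1 m"
| exec_Assign: "exec x (Assign e f) m (exp_cost e + exp_cost f + 1)
    (m(exp_val x m e := exp_val x m f))"
| exec_Seq: "exec x P m s m' \<Longrightarrow> exec x Q m' t m'' \<Longrightarrow> exec x (Seq P Q) m (s + t) m''"
| exec_CondT: "exp_val x m e \<noteq> 0 \<Longrightarrow> exec x P m t m' \<Longrightarrow>
    exec x (Cond e P Q) m (exp_cost e + 1 + t) m'"
| exec_CondF: "exp_val x m e = 0 \<Longrightarrow> exec x Q m t m' \<Longrightarrow>
    exec x (Cond e P Q) m (exp_cost e + 1 + t) m'"
| exec_WhileT: "exp_val x m e \<noteq> 0 \<Longrightarrow> exec x P m s m' \<Longrightarrow> exec x (While e P) m' t m'' \<Longrightarrow>
    exec x (While e P) m (exp_cost e + 1 + s + t) m''"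
| exec_WhileF: "exp_val x m e = 0 \<Longrightarrow> exec x (While e P) m (exp_cost e + 1) m"

inductive_cases exec_SkipE: "exec x Skip m t m'"
inductive_cases exec_AssignE: "exec x (Assign e f) m t m'"
inductive_cases exec_SeqE: "exec x (Seq P Q) m t m'"
inductive_cases exec_CondE: "exec x (Cond e P Q) m t m'"
inductive_cases exec_WhileE: "exec x (While e P) m t m'"

lemma exec_deterministic:
  "exec x P m t m' \<Longrightarrow> exec x P m s m'' \<Longrightarrow> s = t \<and> m'' = m'"
proof (induction arbitrary: s m'' rule: exec.induct)
  case exec_Skip
  then show ?case by (rule exec_SkipE) simp
next
  case exec_Assign
  then show ?case by (rule exec_AssignE) simp
next
  case (exec_Seq P m s1 m1 Q t1 m2)
  from exec_Seq.prems obtain s' n t' where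
    *: "s = s' + t'" "exec x P m s' n" "exec x Q n t' m''" by (rule exec_SeqE)
  from exec_Seq.IH(1)[OF *(2)] *(3) have "s' = s1" "exec x Q m1 t' m''" by simp_all
  with exec_Seq.IH(2)[OF this(2)] *(1) show ?case by simp
next
  case (exec_CondT m e P t1 m1 Q)
  from exec_CondT.prems exec_CondT.hyps(1) obtain t' where
    *: "s = exp_cost e + 1 + t'" "exec x P m t' m''" by (auto elim: exec_CondE)
  with exec_CondT.IH[OF *(2)] show ?case by simp
next
  case (exec_CondF m e Q t1 m1 P)
  from exec_CondF.prems exec_CondF.hyps(1) obtain t' where
    *: "s = exp_cost e + 1 + t'" "exec x Q m t' m''" by (auto elim: exec_CondE)
  with exec_CondF.IH[OF *(2)] show ?case by simp
next
  case (exec_WhileT m e P s1 m1 t1 m2)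
  from exec_WhileT.prems obtain s' n t' where
    *: "s = Suc (exp_cost e + s' + t')" "exec x P m s' n" "exec x (While e P) n t' m''"
    by (rule exec_WhileE) (use exec_WhileT.hyps(1) in auto)
  from exec_WhileT.IH(1)[OF *(2)] *(3) have "s' = s1" "exec x (While e P) m1 t' m''" by simp_all
  with exec_WhileT.IH(2)[OF this(2)] *(1) show ?case by simp
next
  case exec_WhileF
  from exec_WhileF.prems show ?case by (rule exec_WhileE) (use exec_WhileF.hyps in simp_all)
qed

text \<open>The work memory is initially zero, and the answer is read off from cell 0.\<close>

definition answers_within :: "ram_prog \<Rightarrow> nat list \<Rightarrow> bool \<Rightarrow> nat \<Rightarrow> bool" where
  "answers_within P x b T \<longleftrightarrow>
     (\<exists>t m. exec x P (\<lambda>_. 0) t m \<and> t \<le> T \<and> m 0 = (if b then 1 else 0))"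

text \<open>Input format for an automaton with states \<open>{..<n}\<close> and letters \<open>{..<k}\<close>: \<open>n\<close>, \<open>k\<close>, the initial
  state, the characteristic vector of the final states, and the transition table row by row.\<close>

definition encode_dfa :: "nat \<Rightarrow> nat \<Rightarrow> (nat, nat) dfa \<Rightarrow> nat list" where
  "encode_dfa n k M =
     [n, k, initial M] @
     map (\<lambda>q. if q \<in> final M then 1 else 0) [0..<n] @
     concat (map (\<lambda>q. map (delta M q) [0..<k]) [0..<n])"

end

theory Submission
  imports Defs
begin

text \<open>
  A witness \<open>(u, v, w)\<close> is read off a run over \<open>w\<close> that simulates three copies of the automaton and
  guesses for every letter whether it also belongs to \<open>v\<close> and to \<open>u\<close>; a bounded number of modes
  enforces the order. So witnesses correspond to accepting paths in a graph with \<open>O(n\<^sup>3)\<close> vertices and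
  edges, the length of a path being \<open>|w|\<close>, and there are finitely many witnesses iff the lengths of
  the accepting paths from the start vertex are bounded.

  A vertex has some accepting path iff it is found by backward search from the accepting vertices.
  It has accepting paths of bounded length only iff it is eventually removed when one repeatedly
  removes the vertices without accepting paths and those all of whose successors are removed: a
  vertex that is never removed has a successor that is never removed, and each of these still has
  an accepting path. Both computations are instances of one linear-time procedure, \<open>peeling\<close>,
  in which a vertex is found once a counter has been decremented to zero, and which is run on the
  reversed graph. The language is almost convex iff the start vertex is found in both runs.
\<close>

section \<open>The four orders as mode sequences\<close>

text \<open>Factors determine the number five: relative to the occurrence of \<open>u\<close> in
  \<open>v\<close> in \<open>w\<close>, a letter of \<open>w\<close> lies before \<open>v\<close>,
  in \<open>v\<close> before \<open>u\<close>, in \<open>u\<close>, in \<open>v\<close> after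
  \<open>u\<close>, or after \<open>v\<close>. Several paths may describe the same witness, since a
  subword can have many embeddings. This is harmless, because only the set of path lengths is used.
  Conversely, a bound on \<open>|w|\<close> leaves finitely many witnesses, as \<open>u\<close> and
  \<open>v\<close> are no longer than \<open>w\<close> and the alphabet is finite. In the second run
  the vertices without accepting paths must be removed from the outset: a cycle that leads to no
  accepting vertex must not count as a source of long paths. Different letters may give the same
  edge. The edge list keeps all copies, and degrees and decrements both count list positions, so
  they stay consistent. The mode pairs are compiled into the program, whereas \<open>n\<close> and
  \<open>k\<close> are read from the input. Hence one program serves all alphabets, and
  \<open>k\<close> enters only the constant of the time bound. The machine cannot multiply: products
  come from tables filled by repeated addition, constant factors from repeated doubling.\<close>

text \<open>Every letter of \<open>w\<close> is read in one of five modes: in modes 0 and 4 it belongs to \<open>w\<close> only, in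
  modes 1 and 3 also to \<open>v\<close>, and in mode 2 to all of \<open>u\<close>, \<open>v\<close> and \<open>w\<close>. Factors correspond to ascending
  mode sequences from 0, prefixes to those from 2, suffixes to those that stay below 3, and subwords
  to arbitrary sequences of the modes 0, 1, 2.\<close>

definition moves_low :: "nat \<Rightarrow> bool" where
  "moves_low j \<longleftrightarrow> j = 2"

definition moves_mid :: "nat \<Rightarrow> bool" where
  "moves_mid j \<longleftrightarrow> j \<in> {1, 2, 3}"

text \<open>The argument \<open>i\<close> is the mode of the previous letter, and \<open>a\<close>
  is read in the new mode \<open>j\<close>. So the start mode itself reads nothing; it only
  restricts the mode of the first letter.\<close>

fun tracks :: "(nat \<times> nat) set \<Rightarrow> nat \<Rightarrow> 'a list \<Rightarrow> 'a list \<Rightarrow> 'a list \<Rightarrow> bool" where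
  "tracks Tr i u v [] \<longleftrightarrow> u = [] \<and> v = []"
| "tracks Tr i u v (a # w) \<longleftrightarrow>
     (\<exists>j u' v'. (i, j) \<in> Tr \<and> u = (if moves_low j then a # u' else u') \<and>
        v = (if moves_mid j then a # v' else v') \<and> tracks Tr j u' v' w)"

text \<open>A list rather than a set, because the program contains one piece of code per mode
  pair.\<close>

definition ascending :: "nat \<Rightarrow> (nat \<times> nat) list" where
  "ascending b = concat (map (\<lambda>i. map (Pair i) [i..<b]) [0..<b])"

definition unordered :: "nat \<Rightarrow> (nat \<times> nat) list" where
  "unordered b = concat (map (\<lambda>i. map (Pair i) [0..<b]) [0..<b])"

lemma set_ascending: "set (ascending b) = {(i, j). i \<le> j \<and> j < b}"
  by (force simp: ascending_def)

lemma set_unordered: "set (unordered b) = {(i, j). i < b \<and> j < b}"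
  by (auto simp: unordered_def)

lemma ex_less_5: "(\<exists>j<5. P j) \<longleftrightarrow> P 0 \<or> P 1 \<or> P 2 \<or> P 3 \<or> P (4 :: nat)"
  by (auto simp: less_Suc_eq numeral_eq_Suc)

lemma ex_less_3: "(\<exists>j<3. P j) \<longleftrightarrow> P 0 \<or> P 1 \<or> P (2 :: nat)"
  by (auto simp: less_Suc_eq numeral_eq_Suc)

lemma tracks_ascending_Cons:
  "tracks (set (ascending b)) i u v (a # w) \<longleftrightarrow>
     (\<exists>j<b. i \<le> j \<and> (\<exists>u' v'. u = (if moves_low j then a # u' else u') \<and>
        v = (if moves_mid j then a # v' else v') \<and> tracks (set (ascending b)) j u' v' w))"
  by (auto simp: set_ascending)

text \<open>All modes are treated in one induction, since a step from mode \<open>i\<close> leads to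
  any later mode. Each line describes what is left to read: in mode 1, for example, \<open>v\<close>
  has begun but \<open>u\<close> may still begin anywhere in it.\<close>

lemma tracks_ascending_5:
  "(tracks (set (ascending 5)) 4 u v w \<longleftrightarrow> u = [] \<and> v = []) \<and>
   (tracks (set (ascending 5)) 3 u v w \<longleftrightarrow> u = [] \<and> prefix v w) \<and>
   (tracks (set (ascending 5)) 2 u v w \<longleftrightarrow> prefix u v \<and> prefix v w) \<and>
   (tracks (set (ascending 5)) 1 u v w \<longleftrightarrow> sublist u v \<and> prefix v w) \<and>
   (tracks (set (ascending 5)) 0 u v w \<longleftrightarrow> sublist u v \<and> sublist v w)"
proof (induction w arbitrary: u v)
  case Nil
  show ?case by auto
next
  case (Cons a w)
  show ?case
    unfolding tracks_ascending_Cons ex_less_5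
    by (simp add: moves_low_def moves_mid_def Cons.IH prefix_Cons sublist_Cons_right del: One_nat_def)
      (auto simp: prefix_Cons sublist_Cons_right)
qed

lemma tracks_ascending_3:
  "(tracks (set (ascending 3)) 2 u v w \<longleftrightarrow> u = v \<and> v = w) \<and>
   (tracks (set (ascending 3)) 1 u v w \<longleftrightarrow> suffix u v \<and> v = w) \<and>
   (tracks (set (ascending 3)) 0 u v w \<longleftrightarrow> suffix u v \<and> suffix v w)"
proof (induction w arbitrary: u v)
  case Nil
  show ?case by auto
next
  case (Cons a w)
  show ?case
    unfolding tracks_ascending_Cons ex_less_3
    by (simp add: moves_low_def moves_mid_def Cons.IH suffix_Cons del: One_nat_def)
      (auto simp: suffix_Cons)
qed

lemma tracks_unordered_3_Cons:
  "i < 3 \<Longrightarrow> tracks (set (unordered 3)) i u v (a # w) \<longleftrightarrow>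
     (\<exists>j<3. \<exists>u' v'. u = (if moves_low j then a # u' else u') \<and>
        v = (if moves_mid j then a # v' else v') \<and> tracks (set (unordered 3)) j u' v' w)"
  by (auto simp: set_unordered)

lemma subseq_Cons_right:
  "subseq v (a # w) \<longleftrightarrow> subseq v w \<or> (\<exists>v'. v = a # v' \<and> subseq v' w)"
  by (cases v) (auto dest: subseq_Cons')

lemma tracks_unordered_3:
  "i < 3 \<Longrightarrow> tracks (set (unordered 3)) i u v w \<longleftrightarrow> subseq u v \<and> subseq v w"
proof (induction w arbitrary: i u v)
  case Nil
  show ?case by (auto dest: list_emb_Nil2)
next
  case (Cons a w)
  show ?case
    unfolding tracks_unordered_3_Cons[OF Cons.prems] ex_less_3
    by (simp add: moves_low_def moves_mid_def Cons.IH subseq_Cons_right[of _ a] del: One_nat_def)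
      (auto simp: subseq_Cons_right)
qed

lemma order_tracks:
  fixes R :: "'a list \<Rightarrow> 'a list \<Rightarrow> bool"
  assumes "R \<in> {prefix, suffix, sublist, subseq}"
  obtains s tr where "s < 5" "\<And>i j. (i, j) \<in> set tr \<Longrightarrow> i < 5 \<and> j < 5"
    "\<And>u v w. R u v \<and> R v w \<longleftrightarrow> tracks (set tr) s u v w"
proof -
  consider "R = prefix" | "R = suffix" | "R = sublist" | "R = subseq"
    using assms by auto
  then show ?thesis
  proof cases
    case 1
    then show ?thesis
      by (intro that[of 2 "ascending 5"]) (simp_all add: tracks_ascending_5, simp add: set_ascending)
  next
    case 2
    then show ?thesis
      by (intro that[of 0 "ascending 3"]) (simp_all add: tracks_ascending_3, simp add: set_ascending)
  next
    case 3
    then show ?thesis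
      by (intro that[of 0 "ascending 5"]) (simp_all add: tracks_ascending_5, simp add: set_ascending)
  next
    case 4
    then show ?thesis
      by (intro that[of 0 "unordered 3"]) (simp_all add: tracks_unordered_3, simp add: set_unordered)
  qed
qed

text \<open>This is what makes the length of \<open>w\<close> control the whole triple.\<close>

lemma tracks_lists:
  "tracks Tr i u v w \<Longrightarrow> w \<in> lists \<Sigma> \<Longrightarrow>
     u \<in> lists \<Sigma> \<and> v \<in> lists \<Sigma> \<and> length u \<le> length w \<and> length v \<le> length w"
proof (induction w arbitrary: i u v)
  case (Cons a w)
  from Cons.prems(1) obtain j u' v' where
    *: "u = (if moves_low j then a # u' else u')" "v = (if moves_mid j then a # v' else v')"
    "tracks Tr j u' v' w" by auto
  show ?case using Cons.IH[OF *(3)] Cons.prems(2) *(1,2) by auto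
qed simp

section \<open>Accepted path lengths\<close>

definition accepted_lengths :: "('v \<times> 'v) set \<Rightarrow> 'v set \<Rightarrow> 'v \<Rightarrow> nat set" where
  "accepted_lengths E A v = {l. \<exists>y\<in>A. (v, y) \<in> E ^^ l}"

lemma accepted_lengths_rec:
  "accepted_lengths E A v =
     (if v \<in> A then {0} else {}) \<union> Suc ` (\<Union>w\<in>E `` {v}. accepted_lengths E A w)"
proof (rule set_eqI)
  fix l
  show "l \<in> accepted_lengths E A v \<longleftrightarrow> l \<in>
     (if v \<in> A then {0} else {}) \<union> Suc ` (\<Union>w\<in>E `` {v}. accepted_lengths E A w)"
  proof (cases l)
    case 0
    then show ?thesis by (auto simp: accepted_lengths_def)
  next
    case (Suc l')
    then show ?thesis
      by (auto simp: accepted_lengths_def image_iff simp del: relpow.simps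
          dest!: relpow_Suc_D2 intro: relpow_Suc_I2)
  qed
qed

text \<open>Counters in the style of topological sorting: a vertex is removed once at least \<open>c v\<close> of its
  outgoing edges lead to removed vertices. Edges are counted with multiplicity.\<close>

definition edge_count :: "('v \<times> 'v) list \<Rightarrow> 'v \<Rightarrow> 'v set \<Rightarrow> nat" where
  "edge_count es v X = card {e. e < length es \<and> fst (es ! e) = v \<and> snd (es ! e) \<in> X}"

text \<open>The threshold \<open>c v\<close> unifies both computations: 0 means unconditional
  membership, 1 asks for some successor in \<open>X\<close>, and the out-degree asks for all
  successors in \<open>X\<close>.\<close>

definition closed_under :: "('v \<times> 'v) list \<Rightarrow> 'v set \<Rightarrow> ('v \<Rightarrow> nat) \<Rightarrow> 'v set \<Rightarrow> bool" where
  "closed_under es V c X \<longleftrightarrow> (\<forall>v\<in>V. c v \<le> edge_count es v X \<longrightarrow> v \<in> X)"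

definition least_closed :: "('v \<times> 'v) list \<Rightarrow> 'v set \<Rightarrow> ('v \<Rightarrow> nat) \<Rightarrow> 'v set \<Rightarrow> bool" where
  "least_closed es V c S \<longleftrightarrow>
     S \<subseteq> V \<and> closed_under es V c S \<and> (\<forall>X. closed_under es V c X \<longrightarrow> S \<subseteq> X)"

lemma least_closed_cong:
  assumes "\<And>v. v \<in> V \<Longrightarrow> c v = c' v"
  shows "least_closed es V c S \<longleftrightarrow> least_closed es V c' S"
  using assms by (simp add: least_closed_def closed_under_def)

lemma edge_count_pos: "0 < edge_count es v X \<longleftrightarrow> (\<exists>w\<in>X. (v, w) \<in> set es)"
proof -
  have "0 < edge_count es v X \<longleftrightarrow> (\<exists>e<length es. fst (es ! e) = v \<and> snd (es ! e) \<in> X)"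
    by (auto simp: edge_count_def card_gt_0_iff)
  also have "\<dots> \<longleftrightarrow> (\<exists>x\<in>set es. fst x = v \<and> snd x \<in> X)"
    using all_set_conv_all_nth[of es "\<lambda>x. \<not> (fst x = v \<and> snd x \<in> X)"] by blast
  finally show ?thesis unfolding Bex_def split_paired_Ex by auto
qed

text \<open>A subset of a finite set that is at least as large is the whole set. This turns a
  counter that starts at the out-degree into a test of all successors.\<close>

lemma edge_count_full:
  "edge_count es v UNIV \<le> edge_count es v X \<longleftrightarrow> (\<forall>w. (v, w) \<in> set es \<longrightarrow> w \<in> X)"
proof -
  let ?I = "\<lambda>X. {e. e < length es \<and> fst (es ! e) = v \<and> snd (es ! e) \<in> X}"
  have "edge_count es v UNIV \<le> edge_count es v X \<longleftrightarrow> ?I UNIV \<subseteq> ?I X"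
    unfolding edge_count_def
  proof
    assume le: "card (?I UNIV) \<le> card (?I X)"
    have "?I X = ?I UNIV" by (rule card_seteq) (use le in auto)
    then show "?I UNIV \<subseteq> ?I X" by simp
  qed (intro card_mono, auto)
  also have "\<dots> \<longleftrightarrow> (\<forall>x\<in>set es. fst x = v \<longrightarrow> snd x \<in> X)"
    unfolding all_set_conv_all_nth by blast
  finally show ?thesis unfolding Ball_def split_paired_All by auto
qed

text \<open>Soundness is minimality of \<open>S\<close>, applied to the closed set of vertices with
  an accepting path; completeness is closedness of \<open>S\<close>, by induction on the length of
  the path.\<close>

lemma least_closed_coreachable:
  assumes S: "least_closed es V (\<lambda>v. if v \<in> A then 0 else 1) S"
    and V: "set es \<subseteq> V \<times> V" and v: "v \<in> V"
  shows "v \<in> S \<longleftrightarrow> accepted_lengths (set es) A v \<noteq> {}"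
proof
  let ?X = "{v. accepted_lengths (set es) A v \<noteq> {}}"
  have "closed_under es V (\<lambda>v. if v \<in> A then 0 else 1) ?X"
    unfolding closed_under_def
  proof (intro ballI impI)
    fix v assume "(if v \<in> A then 0 else 1) \<le> edge_count es v ?X"
    then have "v \<in> A \<or> 0 < edge_count es v ?X" by (auto split: if_splits)
    then have "v \<in> A \<or> (\<exists>w\<in>?X. (v, w) \<in> set es)" by (simp add: edge_count_pos)
    then show "v \<in> ?X" using accepted_lengths_rec[of "set es" A v] by auto
  qed
  then show "v \<in> S \<Longrightarrow> accepted_lengths (set es) A v \<noteq> {}"
    using S by (auto simp: least_closed_def)
next
  assume "accepted_lengths (set es) A v \<noteq> {}"
  then obtain l y where "y \<in> A" "(v, y) \<in> set es ^^ l" by (auto simp: accepted_lengths_def)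
  then show "v \<in> S" using v
  proof (induction l arbitrary: v)
    case 0
    then show ?case using S by (auto simp: least_closed_def closed_under_def)
  next
    case (Suc l)
    from relpow_Suc_D2[OF Suc.prems(2)] obtain z where
      z: "(v, z) \<in> set es" "(z, y) \<in> set es ^^ l" by blast
    with V Suc have "z \<in> S" by auto
    with z(1) have "0 < edge_count es v S" by (auto simp: edge_count_pos)
    then show ?case using S Suc.prems(3) by (auto simp: least_closed_def closed_under_def Suc_le_eq)
  qed
qed

text \<open>Minimality gives one direction, as the vertices with finitely many lengths form a closed
  set. For the other, a vertex outside \<open>S\<close> starts arbitrarily long paths outside
  \<open>S\<close>, and each of them extends to an accepting path.\<close>

lemma least_closed_finite_lengths:
  assumes S: "least_closed es V
      (\<lambda>v. if accepted_lengths (set es) A v = {} then 0 else edge_count es v UNIV) S"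
    and V: "set es \<subseteq> V \<times> V" and v: "v \<in> V"
  shows "v \<in> S \<longleftrightarrow> finite (accepted_lengths (set es) A v)"
proof
  let ?L = "accepted_lengths (set es) A"
  let ?c = "\<lambda>v. if ?L v = {} then 0 else edge_count es v UNIV"
  have "closed_under es V ?c {v. finite (?L v)}"
    unfolding closed_under_def
  proof (intro ballI impI)
    fix v assume le: "?c v \<le> edge_count es v {v. finite (?L v)}"
    show "v \<in> {v. finite (?L v)}"
    proof (cases "?L v = {}")
      case False
      with le have "\<forall>w. (v, w) \<in> set es \<longrightarrow> finite (?L w)" by (simp add: edge_count_full)
      \<comment> \<open>Finite branching keeps the union over the successors finite.\<close>
      moreover have "finite (set es `` {v})" by (rule finite_Image) simp
      ultimately have "finite (Suc ` (\<Union>w\<in>set es `` {v}. ?L w))" by auto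
      then have "finite (?L v)" by (subst accepted_lengths_rec) auto
      then show ?thesis by simp
    qed simp
  qed
  then show "v \<in> S \<Longrightarrow> finite (?L v)" using S by (auto simp: least_closed_def)
next
  let ?L = "accepted_lengths (set es) A"
  let ?c = "\<lambda>v. if ?L v = {} then 0 else edge_count es v UNIV"
  assume fin: "finite (?L v)"
  show "v \<in> S"
  proof (rule ccontr)
    assume "v \<notin> S"
    \<comment> \<open>A threshold of 0 would force \<open>u\<close> into \<open>S\<close>. So
      \<open>u\<close> has an accepting path and its threshold is the out-degree, which some edge
      leaving \<open>S\<close> keeps from being met.\<close>
    have step: "?L u \<noteq> {} \<and> (\<exists>w. (u, w) \<in> set es \<and> w \<in> V \<and> w \<notin> S)" if u: "u \<in> V" "u \<notin> S" for u
    proof -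
      have "\<not> ?c u \<le> edge_count es u S"
        using S u by (auto simp: least_closed_def closed_under_def)
      then have "?L u \<noteq> {}" "\<not> edge_count es u UNIV \<le> edge_count es u S"
        by (auto split: if_splits)
      then show ?thesis using V by (auto simp: edge_count_full)
    qed
    have far: "\<exists>w. w \<in> V \<and> w \<notin> S \<and> (v, w) \<in> set es ^^ l" for l
    proof (induction l)
      case 0
      show ?case using v \<open>v \<notin> S\<close> by auto
    next
      case (Suc l)
      then show ?case using step by (meson relpow_Suc_I)
    qed
    have "\<exists>l'\<ge>l. l' \<in> ?L v" for l
    proof -
      from far obtain w where w: "w \<in> V" "w \<notin> S" "(v, w) \<in> set es ^^ l" by blast
      from step[OF w(1,2)] obtain l' y where "y \<in> A" "(w, y) \<in> set es ^^ l'"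
        by (auto simp: accepted_lengths_def)
      with w(3) have "(v, y) \<in> set es ^^ (l + l')" "y \<in> A" by (auto simp: relpow_add)
      then have "l + l' \<in> ?L v" by (auto simp: accepted_lengths_def)
      then show ?thesis by (intro exI[of _ "l + l'"]) auto
    qed
    with fin show False by (metis finite_nat_set_iff_bounded_le not_less_eq_eq)
  qed
qed

section \<open>The product graph\<close>

text \<open>Mixed-radix numbering with the mode as lowest digit: the vertices of the triple with
  lexicographic number \<open>L\<close> are \<open>5 * L\<close> to \<open>5 * L + 4\<close>, so
  that "all triples before \<open>L\<close>" becomes a bound on the vertex number.\<close>

definition vertex :: "nat \<Rightarrow> nat \<Rightarrow> nat \<Rightarrow> nat \<Rightarrow> nat \<Rightarrow> nat" where
  "vertex n i p q r = 5 * (p * n * n + q * n + r) + i"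

lemma digits_unique:
  fixes a b c d n :: nat
  assumes "b < n" "d < n" "a * n + b = c * n + d"
  shows "a = c \<and> b = d"
proof -
  have "(a * n + b) div n = a" "(c * n + d) div n = c"
    "(a * n + b) mod n = b" "(c * n + d) mod n = d" using assms(1,2) by auto
  with assms(3) show ?thesis by metis
qed

lemma vertex_inject:
  assumes "i < 5" "i' < 5" "q < n" "r < n" "q' < n" "r' < n"
  shows "vertex n i p q r = vertex n i' p' q' r' \<longleftrightarrow> i = i' \<and> p = p' \<and> q = q' \<and> r = r'"
proof
  assume eq: "vertex n i p q r = vertex n i' p' q' r'"
  from eq assms(1,2) have "p * n * n + q * n + r = p' * n * n + q' * n + r' \<and> i = i'"
    using digits_unique[of i 5 i' "p * n * n + q * n + r" "p' * n * n + q' * n + r'"]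
    by (simp add: vertex_def mult.commute)
  then have "(p * n + q) * n + r = (p' * n + q') * n + r'" "i = i'" by (simp_all add: algebra_simps)
  with digits_unique[OF assms(4,6)] digits_unique[OF assms(3,5)]
  show "i = i' \<and> p = p' \<and> q = q' \<and> r = r'" by blast
qed simp

lemma lexicographic_less:
  fixes p q r n :: nat
  assumes "p < n" "q < n" "r < n"
  shows "p * n * n + q * n + r < n * n * n"
proof -
  have "p * n * n + q * n + r < p * n * n + (q + 1) * n" using assms by simp
  also have "\<dots> \<le> p * n * n + n * n" using assms by (intro add_left_mono mult_right_mono) auto
  also have "\<dots> = (p + 1) * (n * n)" by (simp add: algebra_simps)
  also have "\<dots> \<le> n * (n * n)" using assms by (intro mult_right_mono) auto
  finally show ?thesis by (simp add: algebra_simps)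
qed

lemma vertex_less:
  "i < 5 \<Longrightarrow> p < n \<Longrightarrow> q < n \<Longrightarrow> r < n \<Longrightarrow> vertex n i p q r < 5 * (n * n * n)"
  using lexicographic_less[of p n q r] by (simp add: vertex_def)

locale product_graph =
  fixes n k :: nat and M :: "(nat, nat) dfa" and s :: nat and tr :: "(nat \<times> nat) list"
  assumes dfa: "is_dfa M" and states: "states M = {..<n}" and alphabet: "alphabet M = {..<k}"
    and s_less: "s < 5" and tr_less: "\<And>i j. (i, j) \<in> set tr \<Longrightarrow> i < 5 \<and> j < 5"
begin

definition start :: nat where
  "start = vertex n s (initial M) (initial M) (initial M)"

text \<open>The states \<open>p\<close>, \<open>q\<close>, \<open>r\<close> are those reached on the
  parts of \<open>u\<close>, \<open>v\<close>, \<open>w\<close> read so far; the target mode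
  \<open>j\<close> decides which copies move.\<close>

definition edge :: "nat \<Rightarrow> nat \<Rightarrow> nat \<Rightarrow> nat \<Rightarrow> nat \<times> nat \<Rightarrow> nat \<times> nat" where
  "edge p q r a = (\<lambda>(i, j). (vertex n i p q r,
     vertex n j (if moves_low j then delta M p a else p)
       (if moves_mid j then delta M q a else q) (delta M r a)))"

definition edges :: "(nat \<times> nat) set" where
  "edges = {edge p q r a ij | p q r a ij. p < n \<and> q < n \<and> r < n \<and> a < k \<and> ij \<in> set tr}"

definition accepting :: "nat set" where
  "accepting = {vertex n i p q r | i p q r.
     i < 5 \<and> p < n \<and> q < n \<and> r < n \<and> p \<in> final M \<and> q \<notin> final M \<and> r \<in> final M}"

lemma initial_less: "initial M < n"
  using dfa states by (auto simp: is_dfa_def)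

lemma delta_less: "p < n \<Longrightarrow> a < k \<Longrightarrow> delta M p a < n"
  using dfa states alphabet by (auto simp: is_dfa_def)

lemma edges_bounded: "edges \<subseteq> {..<5 * (n * n * n)} \<times> {..<5 * (n * n * n)}"
  by (auto simp: edges_def edge_def delta_less intro!: vertex_less dest: tr_less)

lemma start_bounded: "start < 5 * (n * n * n)"
  by (simp add: start_def vertex_less s_less initial_less)

text \<open>Injectivity of the numbering recovers mode and states from the source, so only the new
  mode and the letter remain free.\<close>

lemma edges_from_vertex:
  assumes "i < 5" "p < n" "q < n" "r < n"
  shows "(vertex n i p q r, y) \<in> edges \<longleftrightarrow>
    (\<exists>j a. (i, j) \<in> set tr \<and> a < k \<and> y = snd (edge p q r a (i, j)))"
proof
  assume "(vertex n i p q r, y) \<in> edges"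
  then obtain p' q' r' a i' j where
    *: "p' < n" "q' < n" "r' < n" "a < k" "(i', j) \<in> set tr"
      "(vertex n i p q r, y) = edge p' q' r' a (i', j)"
    unfolding edges_def by auto
  then have "vertex n i p q r = vertex n i' p' q' r'" by (simp add: edge_def)
  with * assms have "i = i' \<and> p = p' \<and> q = q' \<and> r = r'"
    by (subst (asm) vertex_inject) (auto dest: tr_less)
  with * show "\<exists>j a. (i, j) \<in> set tr \<and> a < k \<and> y = snd (edge p q r a (i, j))"
    by (metis snd_conv)
next
  assume "\<exists>j a. (i, j) \<in> set tr \<and> a < k \<and> y = snd (edge p q r a (i, j))"
  then obtain j a where "(i, j) \<in> set tr" "a < k" "y = snd (edge p q r a (i, j))" by blast
  moreover have "fst (edge p q r a (i, j)) = vertex n i p q r" by (simp add: edge_def)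
  ultimately show "(vertex n i p q r, y) \<in> edges"
    unfolding edges_def mem_Collect_eq using assms
    by (intro exI[of _ p] exI[of _ q] exI[of _ r] exI[of _ a] exI[of _ "(i, j)"])
      (simp add: prod_eq_iff)
qed

lemma vertex_accepting:
  assumes "i < 5" "p < n" "q < n" "r < n"
  shows "vertex n i p q r \<in> accepting \<longleftrightarrow> p \<in> final M \<and> q \<notin> final M \<and> r \<in> final M"
  using assms by (auto simp: accepting_def vertex_inject)

text \<open>Stated for three independent states and any mode, because the copies diverge after the
  first letter.\<close>

lemma accepting_iff_tracks:
  assumes "i < 5" "p < n" "q < n" "r < n"
  shows "l \<in> accepted_lengths edges accepting (vertex n i p q r) \<longleftrightarrow>
    (\<exists>u v w. length w = l \<and> w \<in> lists {..<k} \<and> tracks (set tr) i u v w \<and>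
       foldl (delta M) p u \<in> final M \<and> foldl (delta M) q v \<notin> final M \<and>
       foldl (delta M) r w \<in> final M)"
  using assms
proof (induction l arbitrary: i p q r)
  case 0
  then show ?case by (auto simp: accepted_lengths_def vertex_accepting)
next
  case (Suc l)
  let ?acc = "\<lambda>p q r u v w. foldl (delta M) p u \<in> final M \<and> foldl (delta M) q v \<notin> final M \<and>
       foldl (delta M) r w \<in> final M"
  let ?p = "\<lambda>j a. if moves_low j then delta M p a else p"
  let ?q = "\<lambda>j a. if moves_mid j then delta M q a else q"
  have "Suc l \<in> accepted_lengths edges accepting (vertex n i p q r) \<longleftrightarrow>
      (\<exists>y. (vertex n i p q r, y) \<in> edges \<and> l \<in> accepted_lengths edges accepting y)"
    by (subst accepted_lengths_rec) auto
  also have "\<dots> \<longleftrightarrow> (\<exists>j a. (i, j) \<in> set tr \<and> a < k \<and>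
      l \<in> accepted_lengths edges accepting (vertex n j (?p j a) (?q j a) (delta M r a)))"
    unfolding edges_from_vertex[OF Suc.prems] edge_def prod.case snd_conv by blast
  also have "\<dots> \<longleftrightarrow> (\<exists>j a. (i, j) \<in> set tr \<and> a < k \<and>
      (\<exists>u v w. length w = l \<and> w \<in> lists {..<k} \<and> tracks (set tr) j u v w \<and>
         ?acc (?p j a) (?q j a) (delta M r a) u v w))"
    by (intro iff_exI conj_cong refl Suc.IH) (use Suc.prems in \<open>auto simp: delta_less dest: tr_less\<close>)
  also have "\<dots> \<longleftrightarrow> (\<exists>u v w. length w = Suc l \<and> w \<in> lists {..<k} \<and> tracks (set tr) i u v w \<and>
      ?acc p q r u v w)" (is "?L \<longleftrightarrow> ?R")
  proof
    assume ?L
    then obtain j a u v w where *: "(i, j) \<in> set tr" "a < k" "length w = l" "w \<in> lists {..<k}"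
      "tracks (set tr) j u v w" "?acc (?p j a) (?q j a) (delta M r a) u v w" by blast
    then show ?R
      by (intro exI[of _ "if moves_low j then a # u else u"]
          exI[of _ "if moves_mid j then a # v else v"] exI[of _ "a # w"]) auto
  next
    assume ?R
    then obtain u v w where *: "length w = Suc l" "w \<in> lists {..<k}" "tracks (set tr) i u v w"
      "?acc p q r u v w" by blast
    then obtain a w' where w: "w = a # w'" by (cases w) auto
    from *(3) obtain j u' v' where j: "(i, j) \<in> set tr" and
      u: "u = (if moves_low j then a # u' else u')" and
      v: "v = (if moves_mid j then a # v' else v')" and t: "tracks (set tr) j u' v' w'"
      unfolding w tracks.simps by blast
    from *(1,2) w have w': "length w' = l" "w' \<in> lists {..<k}" and a: "a < k" by auto
    have acc: "?acc (?p j a) (?q j a) (delta M r a) u' v' w'"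
      using *(4) unfolding u v w by (cases "moves_low j"; cases "moves_mid j") simp_all
    show ?L
      by (rule exI[of _ j], rule exI[of _ a], intro conjI j a,
          rule exI[of _ u'], rule exI[of _ v'], rule exI[of _ w'], intro conjI w' t)
        (use acc in simp_all)
  qed
  finally show ?case .
qed

text \<open>The accepted lengths at \<open>start\<close> are exactly the lengths of \<open>w\<close>
  in witnesses, so emptiness carries over directly.\<close>

lemma almost_convex_iff:
  assumes R: "\<And>u v w. R u v \<and> R v w \<longleftrightarrow> tracks (set tr) s u v w"
  shows "almost_convex (alphabet M) R (lang M) \<longleftrightarrow>
    accepted_lengths edges accepting start \<noteq> {} \<and>
    finite (accepted_lengths edges accepting start)"
proof -
  let ?W = "convexity_witnesses (alphabet M) R (lang M)"
  have L: "accepted_lengths edges accepting start = (\<lambda>(u, v, w). length w) ` ?W"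
  proof (rule set_eqI)
    fix l
    have "(u, v, w) \<in> ?W \<longleftrightarrow> w \<in> lists {..<k} \<and> tracks (set tr) s u v w \<and>
        foldl (delta M) (initial M) u \<in> final M \<and> foldl (delta M) (initial M) v \<notin> final M \<and>
        foldl (delta M) (initial M) w \<in> final M" for u v w
      using tracks_lists[of "set tr" s u v w "{..<k}"] R[of u v w]
      by (auto simp: convexity_witnesses_def lang_def alphabet)
    then show "l \<in> accepted_lengths edges accepting start \<longleftrightarrow> l \<in> (\<lambda>(u, v, w). length w) ` ?W"
      unfolding start_def accepting_iff_tracks[OF s_less initial_less initial_less initial_less]
        image_iff Bex_def split_paired_Ex prod.case
      by metis
  qed
  \<comment> \<open>Finitely many lengths have a maximum \<open>b\<close>, and there are finitely
    many triples of words of length at most \<open>b\<close>.\<close>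
  have "finite ?W" if fin: "finite ((\<lambda>(u, v, w). length w) ` ?W)"
  proof -
    obtain b where b: "\<And>u v w. (u, v, w) \<in> ?W \<Longrightarrow> length w \<le> b"
      using fin by (force simp: finite_nat_set_iff_bounded_le)
    let ?S = "{w. set w \<subseteq> {..<k} \<and> length w \<le> b}"
    have "?W \<subseteq> ?S \<times> ?S \<times> ?S"
    proof
      fix t assume t: "t \<in> ?W"
      obtain u v w where uvw: "t = (u, v, w)" by (cases t)
      with t have "tracks (set tr) s u v w" "w \<in> lists {..<k}"
        by (auto simp: convexity_witnesses_def lang_def alphabet simp flip: R)
      from tracks_lists[OF this] \<open>w \<in> lists {..<k}\<close> b t uvw show "t \<in> ?S \<times> ?S \<times> ?S"
        by fastforce
    qed
    then show ?thesis
      by (rule finite_subset) (intro finite_cartesian_product finite_lists_length_le finite_lessThan)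
  qed
  then show ?thesis unfolding almost_convex_def L by auto
qed

end

section \<open>Peeling\<close>

text \<open>In the linked lists of incoming edges, edge \<open>es ! e\<close> has the pointer \<open>e + 1\<close>, and 0 is the null
  pointer.\<close>

primrec last_in :: "('v \<times> 'v) list \<Rightarrow> 'v \<Rightarrow> nat \<Rightarrow> nat" where
  "last_in es w 0 = 0"
| "last_in es w (Suc i) = (if snd (es ! i) = w then Suc i else last_in es w i)"

lemma last_in_le: "last_in es w i \<le> i"
  by (induction i) auto

lemma snd_last_in: "last_in es w i \<noteq> 0 \<Longrightarrow> snd (es ! (last_in es w i - 1)) = w"
  by (induction i) auto

text \<open>The pointer of \<open>e\<close> is \<open>e + 1\<close>, so the strict inequality says
  that \<open>last_in\<close> is at least this pointer.\<close>

lemma less_last_in: "e < i \<Longrightarrow> snd (es ! e) = w \<Longrightarrow> e < last_in es w i"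
  by (induction i) (auto simp: less_Suc_eq)

lemma last_in_append: "i \<le> length es \<Longrightarrow> last_in (es @ fs) w i = last_in es w i"
  by (induction i) (auto simp: nth_append)

definition zeros :: "nat \<Rightarrow> (nat \<Rightarrow> nat) \<Rightarrow> nat set" where
  "zeros N cnt = {v. v < N \<and> cnt v = 0}"

text \<open>A list is traversed from its latest edge to its earliest, and \<open>cur\<close> is the
  pointer of the next edge to treat. In the open list the treated edges thus have pointer
  \<open>e + 1 > cur\<close>, that is \<open>cur \<le> e\<close>.\<close>

definition scanned :: "(nat \<times> nat) list \<Rightarrow> nat \<Rightarrow> (nat \<Rightarrow> nat) \<Rightarrow> nat list \<Rightarrow> nat \<Rightarrow> nat set" where
  "scanned es N cnt stk cur = {e. e < length es \<and> snd (es ! e) \<in> zeros N cnt - set stk \<and>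
     (cur \<noteq> 0 \<and> snd (es ! e) = snd (es ! (cur - 1)) \<longrightarrow> cur \<le> e)}"

text \<open>The vertices with counter 0 are those found so far; those not on the stack have had their
  incoming edges scanned, except that of the list entered last the edges up to \<open>cur\<close> are pending.\<close>

definition peel_inv :: "(nat \<times> nat) list \<Rightarrow> nat \<Rightarrow> (nat \<Rightarrow> nat) \<Rightarrow> (nat \<Rightarrow> nat) \<Rightarrow> nat list \<Rightarrow> nat \<Rightarrow> bool"
  where
  "peel_inv es N c cnt stk cur \<longleftrightarrow> distinct stk \<and> set stk \<subseteq> zeros N cnt \<and>
     (cur \<noteq> 0 \<longrightarrow> cur \<le> length es \<and> snd (es ! (cur - 1)) \<in> zeros N cnt - set stk) \<and>
     (\<forall>v<N. cnt v = c v - card {e \<in> scanned es N cnt stk cur. fst (es ! e) = v}) \<and>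
     (\<forall>X. closed_under es {..<N} c X \<longrightarrow> zeros N cnt \<subseteq> X)"

text \<open>A potential: edges not yet scanned, vertices not yet found, and stack height. Pushing a
  vertex is free, as it trades an unfound vertex for a stack entry.\<close>

definition peel_work :: "(nat \<times> nat) list \<Rightarrow> nat \<Rightarrow> (nat \<Rightarrow> nat) \<Rightarrow> nat list \<Rightarrow> nat \<Rightarrow> nat" where
  "peel_work es N cnt stk cur =
     (length es - card (scanned es N cnt stk cur)) + (N - card (zeros N cnt)) + length stk"

lemma finite_zeros [simp]: "finite (zeros N cnt)"
  by (simp add: zeros_def)

lemma finite_scanned [simp]: "finite (scanned es N cnt stk cur)"
  by (simp add: scanned_def)

lemma card_zeros_le: "card (zeros N cnt) \<le> N"
  using card_mono[of "{..<N}" "zeros N cnt"] by (auto simp: zeros_def)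

text \<open>Every vertex with counter 0 is still on the stack, so no edge counts as scanned.\<close>

lemma peel_inv_init:
  assumes "distinct stk" "set stk = zeros N c"
  shows "peel_inv es N c c stk 0" "peel_work es N c stk 0 \<le> length es + N"
proof -
  have "scanned es N c stk 0 = {}" using assms by (auto simp: scanned_def)
  then show "peel_inv es N c c stk 0"
    using assms by (auto simp: peel_inv_def closed_under_def zeros_def)
  show "peel_work es N c stk 0 \<le> length es + N"
    using assms card_zeros_le[of N c] by (auto simp: peel_work_def distinct_card[symmetric])
qed

text \<open>Opening the list of \<open>w\<close> at its head scans nothing yet: all edges into
  \<open>w\<close> have pointers up to the head, and a null head means that there are none. Only the
  stack height changes.\<close>

lemma peel_inv_pop:
  assumes inv: "peel_inv es N c cnt (stk @ [w]) 0"
  shows "peel_inv es N c cnt stk (last_in es w (length es))"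
    "peel_work es N cnt stk (last_in es w (length es)) < peel_work es N cnt (stk @ [w]) 0"
proof -
  let ?cur = "last_in es w (length es)"
  have w: "w \<in> zeros N cnt" "w \<notin> set stk" using inv by (auto simp: peel_inv_def)
  have eq: "scanned es N cnt stk ?cur = scanned es N cnt (stk @ [w]) 0"
    using w snd_last_in[of es w "length es"] less_last_in[of _ "length es" es w]
    unfolding scanned_def by fastforce
  show "peel_inv es N c cnt stk ?cur"
    using inv w snd_last_in[of es w "length es"] last_in_le[of es w "length es"]
    by (simp add: peel_inv_def eq)
  show "peel_work es N cnt stk ?cur < peel_work es N cnt (stk @ [w]) 0"
    by (simp add: peel_work_def eq)
qed

text \<open>Treating one edge enlarges the scanned set by exactly that edge. A counter already at 0
  stays there by truncated subtraction, and a vertex is pushed only at the transition from 1 to 0,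
  hence only once.\<close>

lemma peel_inv_edge:
  assumes inv: "peel_inv es N c cnt stk cur" and cur: "cur \<noteq> 0" and es: "set es \<subseteq> {..<N} \<times> {..<N}"
    and v: "v = fst (es ! (cur - 1))" and cur': "cur' = last_in es (snd (es ! (cur - 1))) (cur - 1)"
    and cnt': "cnt' = cnt(v := cnt v - 1)" and stk': "stk' = (if cnt v = 1 then stk @ [v] else stk)"
  shows "peel_inv es N c cnt' stk' cur'"
    "peel_work es N cnt' stk' cur' < peel_work es N cnt stk cur"
proof -
  define e where "e = cur - 1"
  define w where "w = snd (es ! e)"
  let ?D = "scanned es N cnt stk cur" and ?D' = "scanned es N cnt' stk' cur'"
  have e: "e < length es" "cur = Suc e" "v = fst (es ! e)" "cur' = last_in es w e"
    using inv cur v cur' by (auto simp: peel_inv_def e_def w_def)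
  have w: "w \<in> zeros N cnt" "w \<notin> set stk" using inv cur by (auto simp: peel_inv_def e_def w_def)
  have vN: "v < N" using subsetD[OF es nth_mem[OF e(1)]] by (simp add: e(3) mem_Times_iff)
  have sub: "set stk \<subseteq> zeros N cnt" and dist: "distinct stk" using inv by (auto simp: peel_inv_def)
  have zeros': "zeros N cnt' = (if cnt v = 1 then insert v (zeros N cnt) else zeros N cnt)"
    using vN by (auto simp: zeros_def cnt')
  have v_new: "v \<notin> zeros N cnt" if "cnt v = 1" using that by (simp add: zeros_def)
  \<comment> \<open>A newly found vertex goes straight onto the stack, so none of its incoming edges
    become scanned.\<close>
  have popped: "zeros N cnt' - set stk' = zeros N cnt - set stk"
    using v_new sub by (auto simp: zeros' stk')
  have "e \<notin> ?D" using e w by (simp add: scanned_def w_def)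
  have D': "?D' = insert e ?D"
  proof (rule set_eqI)
    fix f
    show "f \<in> ?D' \<longleftrightarrow> f \<in> insert e ?D"
    proof (cases "snd (es ! f) = w")
      case True
      \<comment> \<open>Between \<open>cur'\<close> and \<open>e\<close> the list skips only edges
        with other targets.\<close>
      have "(cur' \<noteq> 0 \<longrightarrow> cur' \<le> f) \<longleftrightarrow> e \<le> f"
        using True e(4) last_in_le[of es w e] less_last_in[of f e es w] by fastforce
      moreover have "f \<in> ?D' \<longleftrightarrow> f < length es \<and> (cur' \<noteq> 0 \<longrightarrow> cur' \<le> f)"
        using w True snd_last_in[of es w e] unfolding scanned_def popped mem_Collect_eq e(4)
        by (cases "last_in es w e = 0") simp_all
      moreover have "f \<in> ?D \<longleftrightarrow> f < length es \<and> Suc e \<le> f"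
        using w True by (simp add: scanned_def e(2) w_def[symmetric])
      ultimately show ?thesis using e(1) by auto
    next
      case False
      then show ?thesis
        using e snd_last_in[of es w e] unfolding scanned_def popped by (auto simp: w_def[symmetric])
    qed
  qed
  have card_D': "card {f \<in> ?D'. fst (es ! f) = u} =
      card {f \<in> ?D. fst (es ! f) = u} + (if u = v then 1 else 0)" for u
  proof (cases "u = v")
    case True
    then have "{f \<in> ?D'. fst (es ! f) = u} = insert e {f \<in> ?D. fst (es ! f) = u}"
      using e(3) by (auto simp: D')
    then show ?thesis using True \<open>e \<notin> ?D\<close> by simp
  next
    case False
    then have "{f \<in> ?D'. fst (es ! f) = u} = {f \<in> ?D. fst (es ! f) = u}"
      using e(3) by (auto simp: D')
    then show ?thesis using False by simp
  qed
  have cnt: "cnt u = c u - card {f \<in> ?D. fst (es ! f) = u}" if "u < N" for u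
    using inv that by (auto simp: peel_inv_def)
  \<comment> \<open>If the counter of \<open>v\<close> drops to 0, at least \<open>c v\<close>
    scanned edges leave \<open>v\<close>; their targets were found before and lie in
    \<open>X\<close>, so closedness of \<open>X\<close> puts \<open>v\<close> into it.\<close>
  have min: "zeros N cnt' \<subseteq> X" if X: "closed_under es {..<N} c X" for X
  proof -
    have Z: "zeros N cnt \<subseteq> X" using inv X by (simp add: peel_inv_def)
    have "v \<in> X" if "cnt v = 1"
    proof -
      have "c v \<le> card {f \<in> ?D'. fst (es ! f) = v}" using cnt[OF vN] that by (simp add: card_D')
      also have "\<dots> \<le> edge_count es v X"
        unfolding edge_count_def D' using Z e(1) w
        by (intro card_mono) (auto simp: scanned_def w_def)
      finally show ?thesis using X vN by (auto simp: closed_under_def)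
    qed
    with Z show ?thesis by (auto simp: zeros')
  qed
  have "cur' \<noteq> 0 \<Longrightarrow> cur' \<le> length es \<and> snd (es ! (cur' - 1)) \<in> zeros N cnt' - set stk'"
    using e last_in_le[of es w e] snd_last_in[of es w e] w by (auto simp: popped)
  moreover have "distinct stk'" "set stk' \<subseteq> zeros N cnt'"
    using dist sub v_new by (auto simp: stk' zeros')
  moreover have "\<forall>u<N. cnt' u = c u - card {f \<in> ?D'. fst (es ! f) = u}"
  proof (intro allI impI)
    fix u assume "u < N"
    then show "cnt' u = c u - card {f \<in> ?D'. fst (es ! f) = u}"
      unfolding card_D' using cnt[of u] by (cases "u = v") (simp_all add: cnt')
  qed
  ultimately show "peel_inv es N c cnt' stk' cur'"
    using min unfolding peel_inv_def by blast
  have "?D' \<subseteq> {..<length es}" by (auto simp: scanned_def)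
  then have "card ?D' \<le> length es" using card_mono[of "{..<length es}" ?D'] by simp
  moreover have "card ?D' = Suc (card ?D)" using \<open>e \<notin> ?D\<close> by (simp add: D')
  moreover have "card (zeros N cnt') = card (zeros N cnt) + (if cnt v = 1 then 1 else 0)"
    using v_new by (simp add: zeros')
  moreover have "length stk' = length stk + (if cnt v = 1 then 1 else 0)" by (simp add: stk')
  ultimately show "peel_work es N cnt' stk' cur' < peel_work es N cnt stk cur"
    using card_zeros_le[of N cnt'] unfolding peel_work_def by linarith
qed

text \<open>With no pending list and an empty stack, all edges into found vertices are scanned. The
  truncated difference is then 0 exactly when the threshold is met, which is closedness.\<close>

lemma peel_inv_finish:
  assumes inv: "peel_inv es N c cnt [] 0"
  shows "least_closed es {..<N} c (zeros N cnt)"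
proof -
  have "{e \<in> scanned es N cnt [] 0. fst (es ! e) = v} =
      {e. e < length es \<and> fst (es ! e) = v \<and> snd (es ! e) \<in> zeros N cnt}" for v
    by (auto simp: scanned_def)
  then have "cnt v = c v - edge_count es v (zeros N cnt)" if "v < N" for v
    using inv that by (simp add: peel_inv_def edge_count_def)
  then have "closed_under es {..<N} c (zeros N cnt)"
    by (auto simp: closed_under_def zeros_def)
  then show ?thesis using inv by (auto simp: least_closed_def peel_inv_def zeros_def)
qed

section \<open>Reasoning about programs\<close>

definition runs :: "nat list \<Rightarrow> ram_prog \<Rightarrow> memory \<Rightarrow> nat \<Rightarrow> (memory \<Rightarrow> bool) \<Rightarrow> bool" where
  "runs x P m T Q \<longleftrightarrow> (\<exists>t m'. exec x P m t m' \<and> t \<le> T \<and> Q m')"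

lemma runs_mono: "runs x P m T Q \<Longrightarrow> T \<le> T' \<Longrightarrow> (\<And>m'. Q m' \<Longrightarrow> Q' m') \<Longrightarrow> runs x P m T' Q'"
  unfolding runs_def by (meson le_trans)

lemma runs_Seq:
  assumes "runs x P m T Q'" "\<And>m'. Q' m' \<Longrightarrow> runs x P' m' T' Q"
  shows "runs x (Seq P P') m (T + T') Q"
  using assms unfolding runs_def by (meson exec_Seq add_mono)

text \<open>The index \<open>d\<close> of the invariant decreases strictly and thus bounds the
  number of iterations as well as proving termination.\<close>

lemma runs_While:
  assumes step: "\<And>d m. I d m \<Longrightarrow> exp_val x m e \<noteq> 0 \<Longrightarrow> runs x P m T (\<lambda>m'. \<exists>d'<d. I d' m')"
  shows "I d m \<Longrightarrow> runs x (While e P) m (d * (T + exp_cost e + 1) + exp_cost e + 1)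
    (\<lambda>m'. (\<exists>d'. I d' m') \<and> exp_val x m' e = 0)"
proof (induction d arbitrary: m rule: less_induct)
  case (less d)
  show ?case
  proof (cases "exp_val x m e = 0")
    case True
    then show ?thesis using less.prems exec_WhileF[OF True, of P] unfolding runs_def by fastforce
  next
    case False
    from step[OF less.prems False] obtain t m' d' where
      1: "exec x P m t m'" "t \<le> T" "d' < d" "I d' m'" by (auto simp: runs_def)
    from less.IH[OF 1(3,4)] obtain t' m'' where
      2: "exec x (While e P) m' t' m''" "t' \<le> d' * (T + exp_cost e + 1) + exp_cost e + 1"
      "\<exists>d'. I d' m''" "exp_val x m'' e = 0" by (auto simp: runs_def)
    have "exp_cost e + 1 + t + t' \<le> Suc d' * (T + exp_cost e + 1) + exp_cost e + 1"
      using 1(2) 2(2) by simp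
    also have "\<dots> \<le> d * (T + exp_cost e + 1) + exp_cost e + 1"
      using 1(3) by (intro add_mono mult_right_mono) auto
    finally show ?thesis
      using exec_WhileT[OF False 1(1) 2(1)] 2(3,4) unfolding runs_def by blast
  qed
qed

primrec loop_free :: "ram_prog \<Rightarrow> bool" where
  "loop_free Skip \<longleftrightarrow> True"
| "loop_free (Assign e f) \<longleftrightarrow> True"
| "loop_free (Seq P Q) \<longleftrightarrow> loop_free P \<and> loop_free Q"
| "loop_free (Cond e P Q) \<longleftrightarrow> loop_free P \<and> loop_free Q"
| "loop_free (While e P) \<longleftrightarrow> False"

primrec max_cost :: "ram_prog \<Rightarrow> nat" where
  "max_cost Skip = 1"
| "max_cost (Assign e f) = exp_cost e + exp_cost f + 1"
| "max_cost (Seq P Q) = max_cost P + max_cost Q"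
| "max_cost (Cond e P Q) = exp_cost e + 1 + max (max_cost P) (max_cost Q)"
| "max_cost (While e P) = 0"

text \<open>A functional semantics that the simplifier can evaluate. Here and in
  \<open>max_cost\<close> the clause for \<open>While\<close> is a dummy value, since only loop-free
  programs are considered.\<close>

primrec result :: "nat list \<Rightarrow> ram_prog \<Rightarrow> memory \<Rightarrow> memory" where
  "result x Skip m = m"
| "result x (Assign e f) m = m(exp_val x m e := exp_val x m f)"
| "result x (Seq P Q) m = result x Q (result x P m)"
| "result x (Cond e P Q) m = (if exp_val x m e \<noteq> 0 then result x P m else result x Q m)"
| "result x (While e P) m = m"

lemma exec_loop_free: "loop_free P \<Longrightarrow> \<exists>t\<le>max_cost P. exec x P m t (result x P m)"
proof (induction P arbitrary: m)
  case Skip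
  then show ?case using exec_Skip by force
next
  case (Assign e f)
  show ?case using exec_Assign[of x e f m] by (metis result.simps(2) max_cost.simps(2) order_refl)
next
  case (Seq P Q)
  then obtain s t where "s \<le> max_cost P" "exec x P m s (result x P m)"
    "t \<le> max_cost Q" "exec x Q (result x P m) t (result x Q (result x P m))" by force
  then show ?case by (auto intro!: exI[of _ "s + t"] exec_Seq)
next
  case (Cond e P Q)
  then obtain s t where "s \<le> max_cost P" "exec x P m s (result x P m)"
    "t \<le> max_cost Q" "exec x Q m t (result x Q m)" by force
  then show ?case
    using exec_CondT[of x m e P s _ Q] exec_CondF[of x m e Q t _ P]
    by (cases "exp_val x m e = 0")
      (force intro: exI[of _ "exp_cost e + 1 + t"], force intro: exI[of _ "exp_cost e + 1 + s"])
qed simp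

lemma runs_loop_free: "loop_free P \<Longrightarrow> Q (result x P m) \<Longrightarrow> runs x P m (max_cost P) Q"
  using exec_loop_free[of P x m] by (auto simp: runs_def)

definition block :: "ram_prog list \<Rightarrow> ram_prog" where
  "block Ps = foldr Seq Ps Skip"

lemma block_simps [simp]:
  "block [] = Skip" "block (P # Ps) = Seq P (block Ps)"
  by (simp_all add: block_def)

lemma loop_free_block: "(\<And>P. P \<in> set Ps \<Longrightarrow> loop_free P) \<Longrightarrow> loop_free (block Ps)"
  by (induction Ps) auto

text \<open>An invariant rule for unrolled loops: the iterations over the five modes and over
  \<open>tr\<close> have fixed length and appear as straight-line code.\<close>

lemma result_block_induct:
  assumes "I 0 m" and "\<And>i m. i < length Ps \<Longrightarrow> I i m \<Longrightarrow> I (Suc i) (result x (Ps ! i) m)"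
  shows "I (length Ps) (result x (block Ps) m)"
  using assms
proof (induction Ps arbitrary: I m)
  case (Cons P Ps)
  show ?case
    using Cons.IH[of "\<lambda>i. I (Suc i)" "result x P m"] Cons.prems(1) Cons.prems(2)[of 0]
      Cons.prems(2)[of "Suc _"] by simp
qed simp

text \<open>The memory is split into sixteen arrays; array 0 holds the scalar variables, so that the
  output cell 0 is scalar 0.\<close>

definition addr :: "nat \<Rightarrow> nat \<Rightarrow> nat" where
  "addr j i = 16 * i + j"

lemma addr_eq_iff [simp]: "j < 16 \<Longrightarrow> j' < 16 \<Longrightarrow> addr j i = addr j' i' \<longleftrightarrow> j = j' \<and> i = i'"
  using digits_unique[of j 16 j' i i'] by (auto simp: addr_def mult.commute)

text \<open>Multiplication by 16 through four doublings. The \<open>let\<close> shares notation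
  only: the expression contains 16 copies of \<open>e\<close>, a constant factor in cost.\<close>

definition addr_exp :: "nat \<Rightarrow> ram_exp \<Rightarrow> ram_exp" where
  "addr_exp j e = (let e2 = Add e e; e4 = Add e2 e2; e8 = Add e4 e4
     in Add (Add e8 e8) (Const j))"

definition Load :: "nat \<Rightarrow> ram_exp \<Rightarrow> ram_exp" where
  "Load j e = Mem (addr_exp j e)"

definition Store :: "nat \<Rightarrow> ram_exp \<Rightarrow> ram_exp \<Rightarrow> ram_prog" where
  "Store j e f = Assign (addr_exp j e) f"

definition Var :: "nat \<Rightarrow> ram_exp" where
  "Var v = Load 0 (Const v)"

definition Set :: "nat \<Rightarrow> ram_exp \<Rightarrow> ram_prog" where
  "Set v e = Store 0 (Const v) e"

definition times5 :: "ram_exp \<Rightarrow> ram_exp" where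
  "times5 e = Add (Add (Add e e) (Add e e)) e"

definition input :: "nat list \<Rightarrow> nat \<Rightarrow> nat" where
  "input x i = (if i < length x then x ! i else 0)"

lemma exp_val_Input [simp]: "exp_val x m (Input e) = input x (exp_val x m e)"
  by (simp add: input_def)

declare exp_val.simps(2) [simp del]

lemma exp_val_addr_exp: "exp_val x m (addr_exp j e) = addr j (exp_val x m e)"
  by (simp add: addr_exp_def addr_def Let_def)

lemma exp_val_macros [simp]:
  "exp_val x m (Load j e) = m (addr j (exp_val x m e))"
  "exp_val x m (Var v) = m (addr 0 v)"
  "exp_val x m (times5 e) = 5 * exp_val x m e"
  by (simp_all add: Load_def Var_def times5_def exp_val_addr_exp)

lemma result_macros [simp]:
  "result x (Store j e f) m = m(addr j (exp_val x m e) := exp_val x m f)"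
  "result x (Set v f) m = m(addr 0 v := exp_val x m f)"
  by (simp_all add: Store_def Set_def exp_val_addr_exp)

lemma loop_free_macros [simp]: "loop_free (Store j e f)" "loop_free (Set v f)"
  by (simp_all add: Store_def Set_def)

text \<open>Truncated subtraction makes the loop condition nonzero exactly while the variable is
  below the bound. The bound is re-evaluated in every round.\<close>

definition For :: "nat \<Rightarrow> ram_exp \<Rightarrow> ram_prog \<Rightarrow> ram_prog" where
  "For v b P = Seq (Set v (Const 0))
     (While (Sub b (Var v)) (Seq P (Set v (Add (Var v) (Const 1)))))"

definition overhead :: "nat \<Rightarrow> ram_exp \<Rightarrow> nat" where
  "overhead v b = max_cost (Set v (Const 0)) + max_cost (Set v (Add (Var v) (Const 1))) +
     exp_cost (Sub b (Var v)) + 1"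

lemma runs_For:
  assumes init: "I 0 (m(addr 0 v := 0))"
    and var: "\<And>i m. i \<le> B \<Longrightarrow> I i m \<Longrightarrow> m (addr 0 v) = i \<and> exp_val x m b = B"
    and step: "\<And>i m. i < B \<Longrightarrow> I i m \<Longrightarrow>
      runs x P m T (\<lambda>m'. m' (addr 0 v) = i \<and> I (Suc i) (m'(addr 0 v := Suc i)))"
  shows "runs x (For v b P) m (B * (T + overhead v b) + overhead v b) (I B)"
proof -
  let ?e = "Sub b (Var v)" and ?c = "max_cost (Set v (Add (Var v) (Const 1)))"
  \<comment> \<open>Here \<open>d\<close> is the number of rounds left.\<close>
  let ?I = "\<lambda>d m. d \<le> B \<and> I (B - d) m"
  have body: "runs x (Seq P (Set v (Add (Var v) (Const 1)))) m (T + ?c) (\<lambda>m'. \<exists>d'<d. ?I d' m')"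
    if "?I d m" "exp_val x m ?e \<noteq> 0" for d m
  proof (rule runs_Seq)
    have d: "d \<noteq> 0" using that var[of "B - d" m] by auto
    then show "runs x P m T (\<lambda>m'. m' (addr 0 v) = B - d \<and> I (B - (d - 1)) (m'(addr 0 v := B - (d - 1))))"
      using that step[of "B - d" m] by (simp add: Suc_diff_le[symmetric])
    fix m' assume "m' (addr 0 v) = B - d \<and> I (B - (d - 1)) (m'(addr 0 v := B - (d - 1)))"
    then show "runs x (Set v (Add (Var v) (Const 1))) m' ?c (\<lambda>m'. \<exists>d'<d. ?I d' m')"
      using d that by (intro runs_loop_free) (auto intro!: exI[of _ "d - 1"] simp: Suc_diff_le[symmetric])
  qed
  have "runs x (For v b P) m (max_cost (Set v (Const 0)) +
      (B * (T + ?c + exp_cost ?e + 1) + exp_cost ?e + 1)) (I B)"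
    unfolding For_def
  proof (rule runs_Seq)
    show "runs x (Set v (Const 0)) m (max_cost (Set v (Const 0))) (I 0)"
      using init by (intro runs_loop_free) simp_all
    fix m' assume "I 0 m'"
    then have "?I B m'" by simp
    from runs_While[where I = ?I, OF body this]
    show "runs x (While ?e (Seq P (Set v (Add (Var v) (Const 1))))) m'
       (B * (T + ?c + exp_cost ?e + 1) + exp_cost ?e + 1) (I B)"
    proof (rule runs_mono)
      fix m'' assume "(\<exists>d. ?I d m'') \<and> exp_val x m'' ?e = 0"
      then obtain d where d: "d \<le> B" "I (B - d) m''" "exp_val x m'' ?e = 0" by blast
      then have "d = 0" using var[of "B - d" m''] by simp
      with d show "I B m''" by simp
    qed auto
  qed
  then show ?thesis
  proof (rule runs_mono)
    have le: "max_cost (Set v (Const 0)) + exp_cost ?e + 1 \<le> overhead v b"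
      by (simp add: overhead_def)
    have "B * (T + ?c + exp_cost ?e + 1) \<le> B * (T + overhead v b)"
      by (intro mult_left_mono) (simp_all add: overhead_def)
    then show "max_cost (Set v (Const 0)) + (B * (T + ?c + exp_cost ?e + 1) + exp_cost ?e + 1)
        \<le> B * (T + overhead v b) + overhead v b"
      using le by linarith
  qed
qed

definition loop_time :: "nat \<Rightarrow> ram_exp \<Rightarrow> nat \<Rightarrow> nat \<Rightarrow> nat" where
  "loop_time v b B T = B * (T + overhead v b) + overhead v b"

lemmas runs_loop = runs_For[folded loop_time_def]

text \<open>Each nested loop raises the exponent by one. The overhead enters twice, once per round
  and once at exit; \<open>n \<ge> 1\<close> lets both be absorbed into the power.\<close>

lemma loop_time_le:
  assumes "1 \<le> n" "T \<le> X * n ^ i"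
  shows "loop_time v b n T \<le> (X + 2 * overhead v b) * n ^ Suc i"
proof -
  have p: "1 \<le> n ^ i" "1 \<le> n ^ Suc i" using assms(1) by (auto intro: one_le_power simp del: power_Suc)
  have "n * (T + overhead v b) \<le> n * (X * n ^ i + overhead v b * n ^ i)"
    using assms(2) p(1) by (intro mult_left_mono add_mono) auto
  moreover have "overhead v b \<le> overhead v b * n ^ Suc i" using p(2) by (metis mult.right_neutral mult_le_mono2)
  moreover have "n * (X * n ^ i + overhead v b * n ^ i) + overhead v b * n ^ Suc i =
      (X + 2 * overhead v b) * n ^ Suc i" by (simp add: algebra_simps)
  ultimately show ?thesis unfolding loop_time_def by linarith
qed

text \<open>A frame condition: \<open>U\<close> holds the cells, as pairs of array and index, that
  may have changed.\<close>

definition agree :: "(nat \<times> nat) set \<Rightarrow> memory \<Rightarrow> memory \<Rightarrow> bool" where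
  "agree U m m' \<longleftrightarrow> (\<forall>j i. j < 16 \<longrightarrow> (j, i) \<notin> U \<longrightarrow> m' (addr j i) = m (addr j i))"

lemma agree_refl: "agree U m m"
  by (simp add: agree_def)

lemma agree_trans: "agree U m m' \<Longrightarrow> agree U' m' m'' \<Longrightarrow> agree (U \<union> U') m m''"
  by (auto simp: agree_def)

lemma agree_mono: "agree U m m' \<Longrightarrow> U \<subseteq> U' \<Longrightarrow> agree U' m m'"
  by (auto simp: agree_def)

lemma agreeD: "agree U m m' \<Longrightarrow> j < 16 \<Longrightarrow> (j, i) \<notin> U \<Longrightarrow> m' (addr j i) = m (addr j i)"
  by (simp add: agree_def)

section \<open>The program\<close>

abbreviation (input) "var_p \<equiv> 1 :: nat"
abbreviation (input) "var_q \<equiv> 2 :: nat"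
abbreviation (input) "var_r \<equiv> 3 :: nat"
abbreviation (input) "var_a \<equiv> 4 :: nat"
abbreviation (input) "var_edges \<equiv> 5 :: nat"
abbreviation (input) "var_top \<equiv> 6 :: nat"
abbreviation (input) "var_cur \<equiv> 7 :: nat"
abbreviation (input) "var_src \<equiv> 8 :: nat"
abbreviation (input) "var_dst \<equiv> 9 :: nat"
abbreviation (input) "var_pa \<equiv> 10 :: nat"
abbreviation (input) "var_qa \<equiv> 11 :: nat"
abbreviation (input) "var_ra \<equiv> 12 :: nat"
abbreviation (input) "var_v \<equiv> 13 :: nat"

abbreviation (input) "arr_n \<equiv> 1 :: nat"
abbreviation (input) "arr_nn \<equiv> 2 :: nat"
abbreviation (input) "arr_k \<equiv> 3 :: nat"
abbreviation (input) "arr_head \<equiv> 4 :: nat"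
abbreviation (input) "arr_next \<equiv> 5 :: nat"
abbreviation (input) "arr_src \<equiv> 6 :: nat"
abbreviation (input) "arr_coreach \<equiv> 7 :: nat"
abbreviation (input) "arr_degree \<equiv> 8 :: nat"
abbreviation (input) "arr_stack \<equiv> 9 :: nat"

text \<open>The arrays \<open>arr_n\<close>, \<open>arr_nn\<close> and \<open>arr_k\<close> are multiplication tables for \<open>n\<close>, \<open>n\<^sup>2\<close> and \<open>k\<close>.
  The counters of the first peeling are in \<open>arr_coreach\<close>; those of the second are in \<open>arr_degree\<close>,
  which initially collects the out-degrees.\<close>

abbreviation (input) "in_n \<equiv> Input (Const 0)"
abbreviation (input) "in_k \<equiv> Input (Const 1)"
abbreviation (input) "in_initial \<equiv> Input (Const 2)"

definition in_final :: "ram_exp \<Rightarrow> ram_exp" where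
  "in_final e = Input (Add (Const 3) e)"

text \<open>The transition table starts after the three header cells and the \<open>n\<close> final
  bits; the row offset comes from the table of multiples of \<open>k\<close>.\<close>

definition in_delta :: "ram_exp \<Rightarrow> ram_exp \<Rightarrow> ram_exp" where
  "in_delta e f = Input (Add (Add (Const 3) in_n) (Add (Load arr_k e) f))"

definition vertex_exp :: "nat \<Rightarrow> ram_exp \<Rightarrow> ram_exp \<Rightarrow> ram_exp \<Rightarrow> ram_exp" where
  "vertex_exp i e f g = Add (times5 (Add (Add (Load arr_nn e) (Load arr_n f)) g)) (Const i)"

text \<open>The entries at 0 are correct because memory starts at zero. The tables include index
  \<open>n\<close>: there \<open>arr_n\<close> holds \<open>n * n\<close>, the increment of the
  second loop, and \<open>arr_nn\<close> holds \<open>n * n * n\<close>, used for the bound of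
  \<open>restart_prog\<close>.\<close>

definition tables_prog :: ram_prog where
  "tables_prog = Seq
     (For var_p in_n (Seq
        (Store arr_n (Add (Var var_p) (Const 1)) (Add (Load arr_n (Var var_p)) in_n))
        (Store arr_k (Add (Var var_p) (Const 1)) (Add (Load arr_k (Var var_p)) in_k))))
     (For var_p in_n
        (Store arr_nn (Add (Var var_p) (Const 1)) (Add (Load arr_nn (Var var_p)) (Load arr_n in_n))))"

definition push_prog :: ram_prog where
  "push_prog = Seq (Store arr_stack (Var var_top) (Var var_v))
     (Set var_top (Add (Var var_top) (Const 1)))"

text \<open>With final bits in {0, 1}, the truncated difference is nonzero only if the bits of
  \<open>p\<close> and \<open>r\<close> are 1 and that of \<open>q\<close> is 0.\<close>

definition mark_prog :: "nat \<Rightarrow> ram_prog" where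
  "mark_prog i = Seq (Set var_v (vertex_exp i (Var var_p) (Var var_q) (Var var_r)))
     (Cond (Sub (Add (in_final (Var var_p)) (in_final (Var var_r)))
              (Add (in_final (Var var_q)) (Const 1)))
        (Seq (Store arr_coreach (Var var_v) (Const 0)) push_prog)
        (Store arr_coreach (Var var_v) (Const 1)))"

text \<open>Prepends an edge to the incoming list of its target and counts it at its source. The
  edge counter is incremented first, so that pointers start at 1.\<close>

definition link_prog :: ram_prog where
  "link_prog = block
     [Set var_edges (Add (Var var_edges) (Const 1)),
      Store arr_src (Var var_edges) (Var var_src),
      Store arr_next (Var var_edges) (Load arr_head (Var var_dst)),
      Store arr_head (Var var_dst) (Var var_edges),
      Store arr_degree (Var var_src) (Add (Load arr_degree (Var var_src)) (Const 1))]"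

definition edge_prog :: "nat \<times> nat \<Rightarrow> ram_prog" where
  "edge_prog = (\<lambda>(i, j). Seq
     (Seq (Set var_src (vertex_exp i (Var var_p) (Var var_q) (Var var_r)))
        (Set var_dst (vertex_exp j (Var (if moves_low j then var_pa else var_p))
           (Var (if moves_mid j then var_qa else var_q)) (Var var_ra))))
     link_prog)"

definition letter_prog :: "(nat \<times> nat) list \<Rightarrow> ram_prog" where
  "letter_prog tr = block
     [Set var_pa (in_delta (Var var_p) (Var var_a)),
      Set var_qa (in_delta (Var var_q) (Var var_a)),
      Set var_ra (in_delta (Var var_r) (Var var_a)),
      block (map edge_prog tr)]"

definition triple_prog :: "(nat \<times> nat) list \<Rightarrow> ram_prog" where
  "triple_prog tr = Seq (block (map mark_prog [0..<5])) (For var_a in_k (letter_prog tr))"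

definition build_prog :: "(nat \<times> nat) list \<Rightarrow> ram_prog" where
  "build_prog tr = For var_p in_n (For var_q in_n (For var_r in_n (triple_prog tr)))"

text \<open>The inner tests single out the value 1: a counter of at least 2 passes the first, 0
  fails the second. With no list open, a vertex is popped and its list opened.\<close>

definition peel_step :: "nat \<Rightarrow> ram_prog" where
  "peel_step c = Cond (Var var_cur)
     (block
       [Set var_v (Load arr_src (Var var_cur)),
        Set var_cur (Load arr_next (Var var_cur)),
        Cond (Sub (Load c (Var var_v)) (Const 1)) Skip
          (Cond (Load c (Var var_v)) push_prog Skip),
        Store c (Var var_v) (Sub (Load c (Var var_v)) (Const 1))])
     (Seq (Set var_top (Sub (Var var_top) (Const 1)))
        (Set var_cur (Load arr_head (Load arr_stack (Var var_top)))))"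

definition peel_prog :: "nat \<Rightarrow> ram_prog" where
  "peel_prog c = While (Add (Var var_cur) (Var var_top)) (peel_step c)"

text \<open>The test holds if the first run did not find the vertex or if it has no outgoing edges,
  that is, if its second counter must start at 0.\<close>

definition restart_step :: ram_prog where
  "restart_step = Cond (Add (Load arr_coreach (Var var_v)) (Sub (Const 1) (Load arr_degree (Var var_v))))
     (Seq (Store arr_degree (Var var_v) (Const 0)) push_prog) Skip"

definition restart_prog :: ram_prog where
  "restart_prog = For var_v (times5 (Load arr_nn in_n)) restart_step"

definition answer_prog :: "nat \<Rightarrow> ram_prog" where
  "answer_prog s = Set 0 (Sub (Const 1)
     (Add (Load arr_coreach (vertex_exp s in_initial in_initial in_initial))
        (Load arr_degree (vertex_exp s in_initial in_initial in_initial))))"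

definition decide_prog :: "nat \<Rightarrow> (nat \<times> nat) list \<Rightarrow> ram_prog" where
  "decide_prog s tr = Seq tables_prog (Seq (build_prog tr) (Seq (peel_prog arr_coreach)
     (Seq restart_prog (Seq (peel_prog arr_degree) (answer_prog s)))))"

section \<open>Running time\<close>

definition tables_time :: "nat \<Rightarrow> nat" where
  "tables_time n = loop_time var_p in_n n (max_cost (Seq
        (Store arr_n (Add (Var var_p) (Const 1)) (Add (Load arr_n (Var var_p)) in_n))
        (Store arr_k (Add (Var var_p) (Const 1)) (Add (Load arr_k (Var var_p)) in_k)))) +
     loop_time var_p in_n n (max_cost
        (Store arr_nn (Add (Var var_p) (Const 1)) (Add (Load arr_nn (Var var_p)) (Load arr_n in_n))))"

definition triple_time :: "nat \<Rightarrow> (nat \<times> nat) list \<Rightarrow> nat" where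
  "triple_time k tr = max_cost (block (map mark_prog [0..<5])) +
     loop_time var_a in_k k (max_cost (letter_prog tr))"

definition build_time :: "nat \<Rightarrow> nat \<Rightarrow> (nat \<times> nat) list \<Rightarrow> nat" where
  "build_time n k tr = loop_time var_p in_n n (loop_time var_q in_n n
     (loop_time var_r in_n n (triple_time k tr)))"

definition peel_time :: "nat \<Rightarrow> nat \<Rightarrow> nat" where
  "peel_time c d = d * (max_cost (peel_step c) + exp_cost (Add (Var var_cur) (Var var_top)) + 1) +
     exp_cost (Add (Var var_cur) (Var var_top)) + 1"

text \<open>The factor \<open>k * length tr + 5\<close> counts, per triple of states, the listed
  edges and the five vertices: the initial potential of a peeling.\<close>

definition decide_time :: "nat \<Rightarrow> (nat \<times> nat) list \<Rightarrow> nat \<Rightarrow> nat \<Rightarrow> nat" where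
  "decide_time s tr k n = tables_time n + (build_time n k tr +
     (peel_time arr_coreach (n * n * n * (k * length tr + 5)) +
     (loop_time var_v (times5 (Load arr_nn in_n)) (5 * (n * n * n)) (max_cost restart_step) +
     (peel_time arr_degree (n * n * n * (k * length tr + 5)) + max_cost (answer_prog s)))))"

lemma decide_time_le: "\<exists>C. \<forall>n\<ge>1. decide_time s tr k n \<le> C * n ^ 3"
proof -
  have le_cube: "a \<le> a * n ^ 3" "a * n \<le> a * n ^ 3" if "1 \<le> n" for a n :: nat
    using that self_le_power[of n 3] by auto
  have linear: "\<exists>C. \<forall>n\<ge>1. loop_time v b n T \<le> C * n ^ 3" for v b T
  proof (intro exI allI impI)
    fix n :: nat assume n: "1 \<le> n"
    have "loop_time v b n T \<le> (T + 2 * overhead v b) * n"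
      using loop_time_le[OF n, of T T 0 v b] by simp
    also have "\<dots> \<le> (T + 2 * overhead v b) * n ^ 3" using n by (rule le_cube)
    finally show "loop_time v b n T \<le> (T + 2 * overhead v b) * n ^ 3" .
  qed
  have affine: "\<exists>C. \<forall>n\<ge>1. n * n * n * Y * z + w \<le> C * n ^ 3" for Y z w :: nat
  proof (intro exI allI impI)
    fix n :: nat assume n: "1 \<le> n"
    have "n * n * n * Y * z + w \<le> n * n * n * Y * z + w * n ^ 3" using le_cube(1)[OF n] by simp
    also have "\<dots> = (Y * z + w) * n ^ 3" by (simp add: power3_eq_cube algebra_simps)
    finally show "n * n * n * Y * z + w \<le> (Y * z + w) * n ^ 3" .
  qed
  have sum: "\<exists>C. \<forall>n\<ge>1. f n + g n \<le> C * n ^ 3"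
    if fg: "\<exists>C. \<forall>n\<ge>1. f n \<le> C * n ^ 3" "\<exists>C. \<forall>n\<ge>1. g n \<le> C * n ^ 3" for f g :: "nat \<Rightarrow> nat"
  proof -
    from fg obtain C D where CD: "\<forall>n\<ge>1. f n \<le> C * n ^ 3" "\<forall>n\<ge>1. g n \<le> D * n ^ 3" by blast
    have "\<forall>n\<ge>1. f n + g n \<le> (C + D) * n ^ 3"
      using CD by (auto simp: add_mult_distrib intro!: add_mono)
    then show ?thesis by blast
  qed
  have build: "\<exists>C. \<forall>n\<ge>1. build_time n k tr \<le> C * n ^ 3"
  proof (intro exI allI impI)
    fix n :: nat assume n: "1 \<le> n"
    \<comment> \<open>For fixed \<open>k\<close> the innermost body has constant cost; each of the
      three loops adds twice its overhead.\<close>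
    show "build_time n k tr \<le> (triple_time k tr + 2 * overhead var_r in_n + 2 * overhead var_q in_n +
        2 * overhead var_p in_n) * n ^ 3"
      unfolding build_time_def numeral_3_eq_3
      by (intro loop_time_le[OF n]) simp
  qed
  have peel: "\<exists>C. \<forall>n\<ge>1. peel_time c (n * n * n * Y) \<le> C * n ^ 3" for c Y
    unfolding peel_time_def add.assoc[of _ "exp_cost _" 1] by (rule affine)
  have restart: "\<exists>C. \<forall>n\<ge>1. loop_time v b (5 * (n * n * n)) T \<le> C * n ^ 3" for v b T
    using affine[of 5 "T + overhead v b" "overhead v b"] by (simp add: loop_time_def ac_simps)
  have const: "\<exists>C. \<forall>n\<ge>1. a \<le> C * n ^ 3" for a :: nat
    using le_cube(1) by blast
  show ?thesis
    unfolding decide_time_def tables_time_def by (intro sum linear build peel restart const)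
qed

section \<open>Correctness of the program\<close>

text \<open>The list structure is given explicitly: since edges are prepended, the successor of edge
  \<open>e\<close> is the last earlier edge with the same target.\<close>

definition linked :: "(nat \<times> nat) list \<Rightarrow> nat \<Rightarrow> memory \<Rightarrow> bool" where
  "linked es N m \<longleftrightarrow>
     (\<forall>w<N. m (addr arr_head w) = last_in es w (length es)) \<and>
     (\<forall>e<length es. m (addr arr_src (Suc e)) = fst (es ! e) \<and>
        m (addr arr_next (Suc e)) = last_in es (snd (es ! e)) e)"

definition stack_is :: "nat list \<Rightarrow> memory \<Rightarrow> bool" where
  "stack_is stk m \<longleftrightarrow> m (addr 0 var_top) = length stk \<and>
     (\<forall>i<length stk. m (addr arr_stack i) = stk ! i)"

lemma result_push_prog:
  "result x push_prog m = m(addr arr_stack (m (addr 0 var_top)) := m (addr 0 var_v),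
     addr 0 var_top := Suc (m (addr 0 var_top)))"
  by (simp add: push_prog_def)

lemma stack_is_push:
  assumes "stack_is stk m"
  shows "stack_is (stk @ [m (addr 0 var_v)]) (result x push_prog m)"
proof -
  have "result x push_prog m = m(addr arr_stack (length stk) := m (addr 0 var_v),
      addr 0 var_top := Suc (length stk))"
    using assms by (simp add: result_push_prog stack_is_def)
  moreover have "(m(addr arr_stack (length stk) := m (addr 0 var_v), addr 0 var_top := Suc (length stk)))
      (addr arr_stack i) = (stk @ [m (addr 0 var_v)]) ! i" if "i < Suc (length stk)" for i
    using assms that by (cases "i = length stk") (simp_all add: stack_is_def nth_append)
  ultimately show ?thesis by (simp add: stack_is_def del: fun_upd_apply) simp
qed

lemma loop_free_push_prog [simp]: "loop_free push_prog"
  by (simp add: push_prog_def)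

abbreviation peel_frame :: "nat \<Rightarrow> (nat \<times> nat) set" where
  "peel_frame c \<equiv> {c, arr_stack} \<times> UNIV \<union> {0} \<times> {var_top, var_cur, var_v}"

lemma linked_agree:
  assumes "linked es N m" "agree U m m'" "U \<inter> {arr_head, arr_next, arr_src} \<times> UNIV = {}"
  shows "linked es N m'"
proof -
  have "m' (addr j i) = m (addr j i)" if "j \<in> {arr_head, arr_next, arr_src}" for j i
  proof (rule agreeD[OF assms(2)])
    show "j < 16" using that by auto
    show "(j, i) \<notin> U" using that assms(3) by blast
  qed
  then show ?thesis using assms(1) by (simp add: linked_def)
qed

text \<open>The two branches of the code realise \<open>peel_inv_pop\<close> and
  \<open>peel_inv_edge\<close> in memory.\<close>

lemma peel_step_correct:
  assumes inv: "peel_inv es N c0 (\<lambda>v. m (addr c v)) stk (m (addr 0 var_cur))"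
    and stk: "stack_is stk m" and lnk: "linked es N m" and es: "set es \<subseteq> {..<N} \<times> {..<N}"
    and c: "c \<in> {arr_coreach, arr_degree}" and busy: "m (addr 0 var_cur) + m (addr 0 var_top) \<noteq> 0"
    and m': "m' = result x (peel_step c) m"
  shows "\<exists>stk'. peel_inv es N c0 (\<lambda>v. m' (addr c v)) stk' (m' (addr 0 var_cur)) \<and> stack_is stk' m' \<and>
    peel_work es N (\<lambda>v. m' (addr c v)) stk' (m' (addr 0 var_cur)) <
      peel_work es N (\<lambda>v. m (addr c v)) stk (m (addr 0 var_cur)) \<and> agree (peel_frame c) m m'"
proof -
  have c': "c < 16" "c \<noteq> 0" "c \<noteq> arr_head" "c \<noteq> arr_next" "c \<noteq> arr_src" "c \<noteq> arr_stack"
    using c by auto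
  show ?thesis
  proof (cases "m (addr 0 var_cur) = 0")
    case True
    with busy stk have "stk \<noteq> []" by (auto simp: stack_is_def)
    then obtain stk' w where sw: "stk = stk' @ [w]" by (metis rev_exhaust)
    then have w: "m (addr arr_stack (length stk')) = w" "m (addr 0 var_top) = Suc (length stk')"
      using stk by (auto simp: stack_is_def)
    have "w < N" using inv by (auto simp: sw peel_inv_def zeros_def)
    then have m'_eq: "m' = m(addr 0 var_top := length stk', addr 0 var_cur := last_in es w (length es))"
      using lnk w True by (simp add: m' peel_step_def linked_def)
    have cnt: "(\<lambda>v. m' (addr c v)) = (\<lambda>v. m (addr c v))"
      using c' by (auto simp: m'_eq)
    have "stack_is stk' m'" using stk by (auto simp: m'_eq stack_is_def sw nth_append)
    moreover have "agree (peel_frame c) m m'" by (auto simp: agree_def m'_eq)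
    moreover note peel_inv_pop[OF inv[unfolded True sw]]
    ultimately show ?thesis unfolding cnt
      by (intro exI[of _ stk']) (simp add: m'_eq sw True)
  next
    case False
    define e where "e = m (addr 0 var_cur) - 1"
    have e: "m (addr 0 var_cur) = Suc e" "e < length es"
      using False inv by (auto simp: e_def peel_inv_def)
    define v where "v = fst (es ! e)"
    define stk' where "stk' = (if m (addr c v) = 1 then stk @ [v] else stk)"
    define m1 where "m1 = m(addr 0 var_v := v, addr 0 var_cur := last_in es (snd (es ! e)) e)"
    define m2 where "m2 = (if m (addr c v) = 1 then result x push_prog m1 else m1)"
    have m'_eq: "m' = m2(addr c v := m (addr c v) - 1)"
      using lnk e c' by (simp add: m' peel_step_def linked_def m1_def m2_def v_def result_push_prog)
    have "stack_is stk m1" using stk by (simp add: m1_def stack_is_def)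
    then have "stack_is stk' m2"
      using stack_is_push[of stk m1 x] by (simp add: m2_def stk'_def) (simp add: m1_def)
    then have stack': "stack_is stk' m'" using c' by (simp add: m'_eq stack_is_def)
    have cnt: "(\<lambda>u. m' (addr c u)) = (\<lambda>u. m (addr c u))(v := m (addr c v) - 1)"
      using c' by (auto simp: m'_eq m2_def m1_def result_push_prog)
    have cur: "m' (addr 0 var_cur) = last_in es (snd (es ! e)) e"
      using c' by (auto simp: m'_eq m2_def m1_def result_push_prog)
    have frame: "agree (peel_frame c) m m'"
      using c' by (auto simp: agree_def m'_eq m2_def m1_def result_push_prog)
    note step = peel_inv_edge[OF inv False es, unfolded e(1) diff_Suc_1, OF v_def refl refl stk'_def]
    show ?thesis
      unfolding cnt cur using step stack' frame by (auto simp: e(1))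
  qed
qed

lemma loop_free_peel_step: "loop_free (peel_step c)"
  by (simp add: peel_step_def)

text \<open>The loop index is the potential \<open>peel_work\<close>, initially at most the number
  of edges plus the number of vertices.\<close>

lemma runs_peel_prog:
  assumes stk: "stack_is stk m" "distinct stk" "set stk = zeros N (\<lambda>v. m (addr c v))"
    and cur: "m (addr 0 var_cur) = 0" and lnk: "linked es N m" and es: "set es \<subseteq> {..<N} \<times> {..<N}"
    and c: "c \<in> {arr_coreach, arr_degree}" and d: "length es + N \<le> d"
  shows "runs x (peel_prog c) m (peel_time c d) (\<lambda>m'.
    least_closed es {..<N} (\<lambda>v. m (addr c v)) (zeros N (\<lambda>v. m' (addr c v))) \<and>
    agree (peel_frame c) m m' \<and> m' (addr 0 var_top) = 0 \<and> m' (addr 0 var_cur) = 0)"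
proof -
  let ?c = "\<lambda>v. m (addr c v)"
  define I where "I = (\<lambda>d m'. \<exists>stk. peel_inv es N ?c (\<lambda>v. m' (addr c v)) stk (m' (addr 0 var_cur)) \<and>
    stack_is stk m' \<and> agree (peel_frame c) m m' \<and>
    d = peel_work es N (\<lambda>v. m' (addr c v)) stk (m' (addr 0 var_cur)))"
  have step: "runs x (peel_step c) m' (max_cost (peel_step c)) (\<lambda>m''. \<exists>d'<d. I d' m'')"
    if "I d m'" "exp_val x m' (Add (Var var_cur) (Var var_top)) \<noteq> 0" for d m'
  proof (rule runs_loop_free[OF loop_free_peel_step])
    from that(1) obtain stk where *: "peel_inv es N ?c (\<lambda>v. m' (addr c v)) stk (m' (addr 0 var_cur))"
      "stack_is stk m'" "agree (peel_frame c) m m'"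
      "d = peel_work es N (\<lambda>v. m' (addr c v)) stk (m' (addr 0 var_cur))" by (auto simp: I_def)
    have "linked es N m'" by (rule linked_agree[OF lnk *(3)]) (use c in auto)
    from peel_step_correct[OF *(1,2) this es c _ refl, of x] that(2)
    obtain stk' where s: "peel_inv es N ?c (\<lambda>v. result x (peel_step c) m' (addr c v)) stk'
        (result x (peel_step c) m' (addr 0 var_cur))" "stack_is stk' (result x (peel_step c) m')"
      "peel_work es N (\<lambda>v. result x (peel_step c) m' (addr c v)) stk'
        (result x (peel_step c) m' (addr 0 var_cur)) < d"
      "agree (peel_frame c) m' (result x (peel_step c) m')"
      unfolding *(4) by auto
    from agree_trans[OF *(3) s(4)] have "agree (peel_frame c) m (result x (peel_step c) m')" by simp
    with s show "\<exists>d'<d. I d' (result x (peel_step c) m')" unfolding I_def by blast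
  qed
  let ?d = "peel_work es N ?c stk 0"
  have init: "I ?d m"
    using peel_inv_init(1)[OF stk(2,3)] stk(1) cur by (auto simp: I_def agree_refl)
  have le: "?d \<le> d" using peel_inv_init(2)[OF stk(2,3), of es] d by linarith
  show ?thesis unfolding peel_prog_def
  proof (rule runs_mono[OF runs_While[where I = I, OF step init]])
    show "?d * (max_cost (peel_step c) + exp_cost (Add (Var var_cur) (Var var_top)) + 1) +
        exp_cost (Add (Var var_cur) (Var var_top)) + 1 \<le> peel_time c d"
      using le unfolding peel_time_def by (intro add_mono mult_right_mono) auto
  next
    fix m' assume "(\<exists>d. I d m') \<and> exp_val x m' (Add (Var var_cur) (Var var_top)) = 0"
    then obtain stk where *: "peel_inv es N ?c (\<lambda>v. m' (addr c v)) stk (m' (addr 0 var_cur))"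
      "stack_is stk m'" "agree (peel_frame c) m m'" "m' (addr 0 var_cur) = 0" "m' (addr 0 var_top) = 0"
      by (auto simp: I_def)
    then have "stk = []" by (simp add: stack_is_def)
    with * show "least_closed es {..<N} ?c (zeros N (\<lambda>v. m' (addr c v))) \<and>
      agree (peel_frame c) m m' \<and> m' (addr 0 var_top) = 0 \<and> m' (addr 0 var_cur) = 0"
      by (simp add: peel_inv_finish)
  qed auto
qed

section \<open>Decoding the input and extending the edge lists\<close>

lemma length_concat_rows:
  "length (concat (map (\<lambda>q. map (f q) [0..<k]) [0..<n])) = n * k"
  by (induction n) auto

lemma nth_concat_rows:
  "p < n \<Longrightarrow> a < k \<Longrightarrow> concat (map (\<lambda>q. map (f q) [0..<k]) [0..<n]) ! (p * k + a) = f p a"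
proof (induction n)
  case (Suc n)
  show ?case
  proof (cases "p = n")
    case True
    then show ?thesis using Suc.prems by (simp add: nth_append length_concat_rows)
  next
    case False
    with Suc.prems have "p < n" by simp
    then have "p * k + a < Suc p * k" "Suc p * k \<le> n * k"
      using Suc.prems by (simp, intro mult_right_mono) auto
    then have "p * k + a < n * k" by linarith
    then show ?thesis using Suc \<open>p < n\<close> by (simp add: nth_append length_concat_rows)
  qed
qed simp

lemma edge_count_append:
  "edge_count (es @ [e]) v UNIV = edge_count es v UNIV + (if fst e = v then 1 else 0)"
proof -
  let ?I = "{i. i < length es \<and> fst (es ! i) = v}"
  have "{i. i < length (es @ [e]) \<and> fst ((es @ [e]) ! i) = v \<and> snd ((es @ [e]) ! i) \<in> UNIV} =
      (if fst e = v then insert (length es) ?I else ?I)"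
    by (auto simp: nth_append less_Suc_eq)
  then show ?thesis by (simp add: edge_count_def)
qed

text \<open>Older edges keep their successors, because \<open>last_in\<close> at an index
  \<open>e\<close> looks only at edges before \<open>e\<close>.\<close>

lemma linked_append:
  assumes lnk: "linked es N m" and b: "b < N"
  shows "linked (es @ [(a, b)]) N (m(addr arr_src (Suc (length es)) := a,
    addr arr_next (Suc (length es)) := m (addr arr_head b), addr arr_head b := Suc (length es)))"
proof -
  have head: "m (addr arr_head w) = last_in es w (length es)" if "w < N" for w
    using lnk that by (simp add: linked_def)
  have edge: "m (addr arr_src (Suc e)) = fst (es ! e) \<and> m (addr arr_next (Suc e)) = last_in es (snd (es ! e)) e"
    if "e < length es" for e
    using lnk that by (simp add: linked_def)
  show ?thesis
    unfolding linked_def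
  proof (intro conjI allI impI)
    fix e assume e: "e < length (es @ [(a, b)])"
    show "(m(addr arr_src (Suc (length es)) := a,
        addr arr_next (Suc (length es)) := m (addr arr_head b), addr arr_head b := Suc (length es)))
        (addr arr_src (Suc e)) = fst ((es @ [(a, b)]) ! e)"
      using edge[of e] e by (cases "e = length es") (simp_all add: nth_append)
    show "(m(addr arr_src (Suc (length es)) := a,
        addr arr_next (Suc (length es)) := m (addr arr_head b), addr arr_head b := Suc (length es)))
        (addr arr_next (Suc e)) = last_in (es @ [(a, b)]) (snd ((es @ [(a, b)]) ! e)) e"
      using edge[of e] e head[OF b]
      by (cases "e = length es") (simp_all add: nth_append last_in_append)
  next
    fix w assume "w < N"
    then show "(m(addr arr_src (Suc (length es)) := a,
        addr arr_next (Suc (length es)) := m (addr arr_head b), addr arr_head b := Suc (length es)))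
        (addr arr_head w) = last_in (es @ [(a, b)]) w (length (es @ [(a, b)]))"
      using head[of w] by (simp add: nth_append last_in_append)
  qed
qed

lemma loop_free_mark_prog [simp]: "loop_free (mark_prog i)"
  by (simp add: mark_prog_def)

lemma loop_free_link_prog [simp]: "loop_free link_prog"
  by (simp add: link_prog_def)

lemma loop_free_edge_prog [simp]: "loop_free (edge_prog ij)"
  by (cases ij) (simp add: edge_prog_def)

lemma loop_free_letter_prog: "loop_free (letter_prog tr)"
  by (auto simp: letter_prog_def intro!: loop_free_block)

context product_graph
begin

abbreviation "enc \<equiv> encode_dfa n k M"
abbreviation "verts \<equiv> 5 * (n * n * n)"

lemma length_enc: "length enc = 3 + n + n * k"
  by (simp add: encode_dfa_def length_concat_rows)

lemma input_header [simp]: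
  "input enc 0 = n" "input enc (Suc 0) = k" "input enc 2 = initial M"
  by (simp_all add: input_def length_enc) (simp_all add: encode_dfa_def)

lemma input_final: "q < n \<Longrightarrow> input enc (3 + q) = (if q \<in> final M then 1 else 0)"
  by (simp add: input_def length_enc) (simp add: encode_dfa_def nth_append)

lemma input_delta:
  assumes "q < n" "a < k"
  shows "input enc (3 + n + (q * k + a)) = delta M q a"
proof -
  have "q * k + a < Suc q * k" "Suc q * k \<le> n * k" using assms by (simp, intro mult_right_mono) auto
  then have "q * k + a < n * k" by linarith
  then show ?thesis
    using assms nth_concat_rows[of q n a k "delta M"]
    by (simp add: input_def length_enc) (simp add: encode_dfa_def nth_append)
qed

definition tables :: "memory \<Rightarrow> bool" where
  "tables m \<longleftrightarrow> (\<forall>p\<le>n. m (addr arr_n p) = p * n \<and> m (addr arr_k p) = p * k \<and>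
     m (addr arr_nn p) = p * n * n)"

definition graph_mem :: "(nat \<times> nat) list \<Rightarrow> memory \<Rightarrow> bool" where
  "graph_mem es m \<longleftrightarrow> m (addr 0 var_edges) = length es \<and> linked es verts m \<and>
     (\<forall>v<verts. m (addr arr_degree v) = edge_count es v UNIV) \<and>
     set es \<subseteq> {..<verts} \<times> {..<verts}"

definition marked :: "nat \<Rightarrow> memory \<Rightarrow> bool" where
  "marked b m \<longleftrightarrow> (\<exists>stk. stack_is stk m \<and> distinct stk \<and> set stk = {v \<in> accepting. v < b}) \<and>
     (\<forall>v<b. m (addr arr_coreach v) = (if v \<in> accepting then 0 else 1))"

text \<open>The state after the first \<open>L\<close> triples in lexicographic order. The set fixes
  the graph; the length, which counts repeated edges, is needed for the time bound.\<close>

definition built :: "nat \<Rightarrow> memory \<Rightarrow> bool" where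
  "built L m \<longleftrightarrow> tables m \<and> m (addr 0 var_cur) = 0 \<and> marked (5 * L) m \<and>
     (\<exists>es. graph_mem es m \<and> set es = {e \<in> edges. fst e < 5 * L} \<and> length es = L * (k * length tr))"

lemma tables_agree:
  assumes "tables m" "agree U m m'" "U \<inter> {arr_n, arr_nn, arr_k} \<times> UNIV = {}"
  shows "tables m'"
proof -
  have "m' (addr j i) = m (addr j i)" if "j \<in> {arr_n, arr_nn, arr_k}" for j i
  proof (rule agreeD[OF assms(2)])
    show "j < 16" using that by auto
    show "(j, i) \<notin> U" using that assms(3) by blast
  qed
  then show ?thesis using assms(1) by (simp add: tables_def)
qed

lemma graph_mem_agree:
  assumes "graph_mem es m" "agree U m m'"
    and U: "U \<inter> {arr_head, arr_next, arr_src} \<times> UNIV = {}" "U \<inter> {arr_degree} \<times> UNIV = {}"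
      "(0, var_edges) \<notin> U"
  shows "graph_mem es m'"
proof -
  have "m' (addr arr_degree i) = m (addr arr_degree i)" for i
    by (rule agreeD[OF assms(2)]) (use U in auto)
  moreover have "m' (addr 0 var_edges) = m (addr 0 var_edges)"
    by (rule agreeD[OF assms(2)]) (use U in auto)
  moreover have "linked es verts m'"
    using assms(1) by (intro linked_agree[OF _ assms(2) U(1)]) (simp add: graph_mem_def)
  ultimately show ?thesis using assms(1) by (simp add: graph_mem_def)
qed

lemma marked_agree:
  assumes "marked b m" "agree U m m'"
    and U: "U \<inter> {arr_coreach, arr_stack} \<times> UNIV = {}" "(0, var_top) \<notin> U"
  shows "marked b m'"
proof -
  have "m' (addr j i) = m (addr j i)" if "j \<in> {arr_coreach, arr_stack}" for j i
  proof (rule agreeD[OF assms(2)])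
    show "j < 16" using that by auto
    show "(j, i) \<notin> U" using that U(1) by blast
  qed
  moreover have "m' (addr 0 var_top) = m (addr 0 var_top)"
    by (rule agreeD[OF assms(2)]) (use U in auto)
  ultimately show ?thesis using assms(1) by (simp add: marked_def stack_is_def)
qed

lemma built_agree:
  assumes "built L m" "agree ({0} \<times> {var_p, var_q, var_r, var_a}) m m'"
  shows "built L m'"
proof -
  have "m' (addr 0 var_cur) = m (addr 0 var_cur)" by (rule agreeD[OF assms(2)]) auto
  moreover have "tables m'" "marked (5 * L) m'"
    using assms(1) tables_agree[OF _ assms(2)] marked_agree[OF _ assms(2)] by (auto simp: built_def)
  moreover have "graph_mem es m \<Longrightarrow> graph_mem es m'" for es
    by (rule graph_mem_agree[OF _ assms(2)]) auto
  ultimately show ?thesis using assms(1) by (auto simp: built_def)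
qed

lemma built_upd:
  assumes "built L m" "v \<in> {var_p, var_q, var_r, var_a}"
  shows "built L (m(addr 0 v := y))"
  by (rule built_agree[OF assms(1)]) (use assms(2) in \<open>auto simp: agree_def\<close>)

lemma exp_val_vertex_exp:
  assumes "tables m" "exp_val x m e \<le> n" "exp_val x m f \<le> n"
  shows "exp_val x m (vertex_exp i e f g) = vertex n i (exp_val x m e) (exp_val x m f) (exp_val x m g)"
  using assms by (simp add: vertex_exp_def vertex_def tables_def)

lemma exp_val_in_final:
  "exp_val enc m e < n \<Longrightarrow> exp_val enc m (in_final e) = (if exp_val enc m e \<in> final M then 1 else 0)"
  by (simp add: in_final_def input_final)

lemma exp_val_in_delta:
  "tables m \<Longrightarrow> exp_val enc m e < n \<Longrightarrow> exp_val enc m f < k \<Longrightarrow>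
   exp_val enc m (in_delta e f) = delta M (exp_val enc m e) (exp_val enc m f)"
  by (simp add: in_delta_def tables_def input_delta)

abbreviation located :: "nat \<Rightarrow> nat \<Rightarrow> nat \<Rightarrow> memory \<Rightarrow> bool" where
  "located p q r m \<equiv> m (addr 0 var_p) = p \<and> m (addr 0 var_q) = q \<and> m (addr 0 var_r) = r"

section \<open>Building the tables and the product graph in memory\<close>

lemma runs_tables_prog:
  "runs enc tables_prog (\<lambda>_. 0) (tables_time n)
     (\<lambda>m. tables m \<and> agree ({arr_n, arr_nn, arr_k} \<times> UNIV \<union> {(0, var_p)}) (\<lambda>_. 0) m)"
  unfolding tables_prog_def tables_time_def
proof (rule runs_Seq)
  let ?I = "\<lambda>i m. (\<forall>p\<le>i. m (addr arr_n p) = p * n \<and> m (addr arr_k p) = p * k) \<and>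
      m (addr 0 var_p) = i \<and> agree ({arr_n, arr_k} \<times> UNIV \<union> {(0, var_p)}) (\<lambda>_. 0) m"
  show "runs enc (For var_p in_n (Seq
        (Store arr_n (Add (Var var_p) (Const 1)) (Add (Load arr_n (Var var_p)) in_n))
        (Store arr_k (Add (Var var_p) (Const 1)) (Add (Load arr_k (Var var_p)) in_k)))) (\<lambda>_. 0)
     (loop_time var_p in_n n (max_cost (Seq
        (Store arr_n (Add (Var var_p) (Const 1)) (Add (Load arr_n (Var var_p)) in_n))
        (Store arr_k (Add (Var var_p) (Const 1)) (Add (Load arr_k (Var var_p)) in_k))))) (?I n)"
    by (rule runs_loop[where I = ?I], simp add: agree_def, simp, rule runs_loop_free)
      (auto simp: agree_def le_Suc_eq)
next
  let ?J = "\<lambda>i m. (\<forall>p\<le>n. m (addr arr_n p) = p * n \<and> m (addr arr_k p) = p * k) \<and>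
      (\<forall>p\<le>i. m (addr arr_nn p) = p * n * n) \<and>
      m (addr 0 var_p) = i \<and> agree ({arr_n, arr_nn, arr_k} \<times> UNIV \<union> {(0, var_p)}) (\<lambda>_. 0) m"
  fix m assume m: "(\<forall>p\<le>n. m (addr arr_n p) = p * n \<and> m (addr arr_k p) = p * k) \<and>
      m (addr 0 var_p) = n \<and> agree ({arr_n, arr_k} \<times> UNIV \<union> {(0, var_p)}) (\<lambda>_. 0) m"
  have "runs enc (For var_p in_n
        (Store arr_nn (Add (Var var_p) (Const 1)) (Add (Load arr_nn (Var var_p)) (Load arr_n in_n)))) m
     (loop_time var_p in_n n (max_cost
        (Store arr_nn (Add (Var var_p) (Const 1)) (Add (Load arr_nn (Var var_p)) (Load arr_n in_n))))) (?J n)"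
  proof (rule runs_loop[where I = ?J])
    show "?J 0 (m(addr 0 var_p := 0))" using m by (simp add: agree_def)
    fix i m assume J: "?J i m"
    then show "m (addr 0 var_p) = i \<and> exp_val enc m in_n = n" by simp
    assume "i < n"
    let ?P = "Store arr_nn (Add (Var var_p) (Const 1)) (Add (Load arr_nn (Var var_p)) (Load arr_n in_n))"
    have "result enc ?P m = m(addr arr_nn (Suc i) := Suc i * n * n)"
      using J by (simp add: add_mult_distrib add.commute)
    then show "runs enc ?P m (max_cost ?P)
        (\<lambda>m'. m' (addr 0 var_p) = i \<and> ?J (Suc i) (m'(addr 0 var_p := Suc i)))"
      using J by (intro runs_loop_free) (simp_all add: agree_def le_Suc_eq del: result_macros)
  qed
  then show "runs enc (For var_p in_n
        (Store arr_nn (Add (Var var_p) (Const 1)) (Add (Load arr_nn (Var var_p)) (Load arr_n in_n)))) m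
     (loop_time var_p in_n n (max_cost
        (Store arr_nn (Add (Var var_p) (Const 1)) (Add (Load arr_nn (Var var_p)) (Load arr_n in_n)))))
     (\<lambda>m. tables m \<and> agree ({arr_n, arr_nn, arr_k} \<times> UNIV \<union> {(0, var_p)}) (\<lambda>_. 0) m)"
    by (rule runs_mono) (auto simp: tables_def)
qed

lemma mark_prog_correct:
  assumes tab: "tables m" and at: "located p q r m" and less: "i < 5" "p < n" "q < n" "r < n"
    and mk: "marked (vertex n i p q r) m" and m': "m' = result enc (mark_prog i) m"
  shows "marked (Suc (vertex n i p q r)) m' \<and>
    agree ({arr_coreach, arr_stack} \<times> UNIV \<union> {0} \<times> {var_top, var_v}) m m'"
proof -
  define v where "v = vertex n i p q r"
  obtain stk where stk: "stack_is stk m" "distinct stk" "set stk = {u \<in> accepting. u < v}"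
    and old: "\<And>u. u < v \<Longrightarrow> m (addr arr_coreach u) = (if u \<in> accepting then 0 else 1)"
    using mk by (auto simp: marked_def v_def)
  define m1 where "m1 = m(addr 0 var_v := v)"
  have "exp_val enc m (vertex_exp i (Var var_p) (Var var_q) (Var var_r)) = v"
    using at less by (simp add: exp_val_vertex_exp[OF tab] v_def)
  moreover have "exp_val enc m1 (in_final (Var var_p)) = (if p \<in> final M then 1 else 0)"
    "exp_val enc m1 (in_final (Var var_q)) = (if q \<in> final M then 1 else 0)"
    "exp_val enc m1 (in_final (Var var_r)) = (if r \<in> final M then 1 else 0)"
    using at less by (simp_all add: exp_val_in_final m1_def)
  ultimately have m'_eq: "m' = (if v \<in> accepting then result enc push_prog (m1(addr arr_coreach v := 0))
      else m1(addr arr_coreach v := 1))"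
    using vertex_accepting[OF less] by (simp add: m' mark_prog_def m1_def v_def)
  have agr: "agree ({arr_coreach, arr_stack} \<times> UNIV \<union> {0} \<times> {var_top, var_v}) m m'"
    by (auto simp: agree_def m'_eq m1_def result_push_prog)
  have "m' (addr arr_coreach u) = (if u \<in> accepting then 0 else 1)" if "u < Suc v" for u
    using old[of u] that by (cases "u = v") (simp_all add: m'_eq m1_def result_push_prog)
  moreover have "\<exists>stk. stack_is stk m' \<and> distinct stk \<and> set stk = {u \<in> accepting. u < Suc v}"
  proof (cases "v \<in> accepting")
    case True
    have "stack_is stk (m1(addr arr_coreach v := 0))" using stk(1) by (simp add: stack_is_def m1_def)
    from stack_is_push[OF this, of enc] have "stack_is (stk @ [v]) m'"
      using True by (simp add: m'_eq m1_def)
    moreover have "set (stk @ [v]) = {u \<in> accepting. u < Suc v}" "distinct (stk @ [v])"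
      using stk True by (auto simp: less_Suc_eq)
    ultimately show ?thesis by blast
  next
    case False
    then have "stack_is stk m'" using stk(1) by (simp add: stack_is_def m'_eq m1_def)
    moreover have "set stk = {u \<in> accepting. u < Suc v}"
      using stk(3) False by (auto simp: less_Suc_eq)
    ultimately show ?thesis using stk(2) by blast
  qed
  ultimately show ?thesis using agr by (simp add: marked_def v_def)
qed

text \<open>The five vertices of a triple are consecutive, so marking them in order extends the
  marked initial segment.\<close>

lemma marks_correct:
  assumes tab: "tables m" and at: "located p q r m" and less: "p < n" "q < n" "r < n"
    and L: "L = p * n * n + q * n + r" and mk: "marked (5 * L) m"
    and m': "m' = result enc (block (map mark_prog [0..<5])) m"
  shows "marked (5 * Suc L) m' \<and>
    agree ({arr_coreach, arr_stack} \<times> UNIV \<union> {0} \<times> {var_top, var_v}) m m'"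
proof -
  let ?U = "{arr_coreach, arr_stack} \<times> UNIV \<union> {0} \<times> {var_top, var_v}"
  let ?I = "\<lambda>i m'. marked (5 * L + i) m' \<and> agree ?U m m'"
  have "?I (length (map mark_prog [0..<5])) m'"
    unfolding m'
  proof (rule result_block_induct)
    show "?I 0 m" using mk by (simp add: agree_refl)
  next
    fix i m1 assume i: "i < length (map mark_prog [0..<5])" and I: "?I i m1"
    then have "tables m1" by (intro tables_agree[OF tab, of ?U m1]) auto
    moreover have "located p q r m1" using at I agreeD[of ?U m m1 0] by simp
    moreover have "marked (vertex n i p q r) m1" using I by (simp add: vertex_def L)
    ultimately have "marked (Suc (vertex n i p q r)) (result enc (mark_prog i) m1) \<and>
        agree ?U m1 (result enc (mark_prog i) m1)"
      using i less by (intro mark_prog_correct) simp_all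
    then show "?I (Suc i) (result enc (map mark_prog [0..<5] ! i) m1)"
      using i I agree_trans[of ?U m m1 ?U "result enc (mark_prog i) m1"]
      by (simp add: vertex_def L)
  qed
  then show ?thesis by (simp add: add.commute)
qed

abbreviation link_frame :: "(nat \<times> nat) set" where
  "link_frame \<equiv> {arr_head, arr_next, arr_src, arr_degree} \<times> UNIV \<union> {0} \<times> {var_edges, var_src, var_dst}"

lemma link_prog_correct:
  assumes g: "graph_mem es m" and a: "m (addr 0 var_src) = a" "a < verts"
    and b: "m (addr 0 var_dst) = b" "b < verts" and m': "m' = result enc link_prog m"
  shows "graph_mem (es @ [(a, b)]) m' \<and> agree link_frame m m'"
proof -
  define m1 where "m1 = m(addr arr_src (Suc (length es)) := a,
    addr arr_next (Suc (length es)) := m (addr arr_head b), addr arr_head b := Suc (length es))"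
  have len: "m (addr 0 var_edges) = length es" and lnk: "linked es verts m"
    and deg: "\<And>v. v < verts \<Longrightarrow> m (addr arr_degree v) = edge_count es v UNIV"
    and sub: "set es \<subseteq> {..<verts} \<times> {..<verts}"
    using g by (auto simp: graph_mem_def)
  have upd: "m' (addr j i) = (if (j, i) = (0, var_edges) then Suc (length es)
      else if (j, i) = (arr_degree, a) then Suc (m (addr arr_degree a)) else m1 (addr j i))"
    if "j < 16" for j i
    using that by (simp add: m' link_prog_def len a b m1_def)
  have "linked (es @ [(a, b)]) verts m1"
    unfolding m1_def using lnk b(2) by (rule linked_append)
  then have "linked (es @ [(a, b)]) verts m'"
    by (simp add: linked_def upd)
  moreover have "m' (addr arr_degree v) = edge_count (es @ [(a, b)]) v UNIV" if "v < verts" for v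
    using deg[OF that] by (cases "v = a") (simp_all add: upd edge_count_append m1_def)
  moreover have "m' (addr 0 var_edges) = length (es @ [(a, b)])" by (simp add: upd)
  moreover have "set (es @ [(a, b)]) \<subseteq> {..<verts} \<times> {..<verts}" using sub a(2) b(2) by simp
  ultimately have "graph_mem (es @ [(a, b)]) m'" unfolding graph_mem_def by blast
  moreover have "agree link_frame m m'" by (auto simp: agree_def upd m1_def)
  ultimately show ?thesis ..
qed

lemma edge_prog_correct:
  assumes g: "graph_mem es m" and tab: "tables m" and at: "located p q r m"
    and less: "p < n" "q < n" "r < n" "a < k" and ij: "ij \<in> set tr"
    and d: "m (addr 0 var_pa) = delta M p a" "m (addr 0 var_qa) = delta M q a"
      "m (addr 0 var_ra) = delta M r a"
    and m': "m' = result enc (edge_prog ij) m"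
  shows "graph_mem (es @ [edge p q r a ij]) m' \<and> agree link_frame m m'"
proof -
  obtain i j where [simp]: "ij = (i, j)" by (cases ij)
  have "edge p q r a (i, j) \<in> edges" using less ij unfolding edges_def mem_Collect_eq \<open>ij = (i, j)\<close> by blast
  then have bound: "fst (edge p q r a (i, j)) < verts" "snd (edge p q r a (i, j)) < verts"
    using edges_bounded by (auto simp: mem_Times_iff)
  define m1 where "m1 = m(addr 0 var_src := fst (edge p q r a (i, j)))"
  define m2 where "m2 = m1(addr 0 var_dst := snd (edge p q r a (i, j)))"
  have "exp_val enc m (vertex_exp i (Var var_p) (Var var_q) (Var var_r)) = fst (edge p q r a (i, j))"
    using at less by (simp add: exp_val_vertex_exp[OF tab] edge_def)
  moreover have tab1: "tables m1" by (rule tables_agree[OF tab, of "{(0, var_src)}"]) (auto simp: agree_def m1_def)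
  have "exp_val enc m1 (vertex_exp j (Var (if moves_low j then var_pa else var_p))
      (Var (if moves_mid j then var_qa else var_q)) (Var var_ra)) = snd (edge p q r a (i, j))"
    by (subst exp_val_vertex_exp[OF tab1])
      (use at less d delta_less[of p a] delta_less[of q a] in \<open>auto simp: m1_def edge_def less_imp_le\<close>)
  ultimately have "m' = result enc link_prog m2"
    by (simp add: m' edge_prog_def m1_def m2_def)
  moreover have agr: "agree ({0} \<times> {var_src, var_dst}) m m2" by (auto simp: agree_def m1_def m2_def)
  moreover have "graph_mem es m2" by (rule graph_mem_agree[OF g agr]) auto
  moreover have "m2 (addr 0 var_src) = fst (edge p q r a (i, j))"
    "m2 (addr 0 var_dst) = snd (edge p q r a (i, j))" by (simp_all add: m1_def m2_def)
  ultimately have "graph_mem (es @ [edge p q r a ij]) m'" "agree link_frame m2 m'"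
    using link_prog_correct[of es m2 "fst (edge p q r a (i, j))" "snd (edge p q r a (i, j))" m'] bound
    by simp_all
  with agree_trans[OF agr this(2)] show ?thesis by (auto elim!: agree_mono)
qed

abbreviation letter_frame :: "(nat \<times> nat) set" where
  "letter_frame \<equiv> link_frame \<union> {0} \<times> {var_pa, var_qa, var_ra}"

lemma letter_prog_correct:
  assumes g: "graph_mem es m" and tab: "tables m" and at: "located p q r m" "m (addr 0 var_a) = a"
    and less: "p < n" "q < n" "r < n" "a < k"
    and m': "m' = result enc (letter_prog tr) m"
  shows "graph_mem (es @ map (edge p q r a) tr) m' \<and> agree letter_frame m m'"
proof -
  define m1 where "m1 = m(addr 0 var_pa := delta M p a)"
  define m2 where "m2 = m1(addr 0 var_qa := delta M q a)"
  define m3 where "m3 = m2(addr 0 var_ra := delta M r a)"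
  let ?U = "{0} \<times> {var_pa, var_qa, var_ra}"
  have agr: "agree ?U m m1" "agree ?U m m2" "agree ?U m m3"
    by (auto simp: agree_def m1_def m2_def m3_def)
  have tabs: "tables m1" "tables m2" "tables m3"
    using tables_agree[OF tab agr(1)] tables_agree[OF tab agr(2)] tables_agree[OF tab agr(3)]
    by auto
  have "exp_val enc m (in_delta (Var var_p) (Var var_a)) = delta M p a"
    "exp_val enc m1 (in_delta (Var var_q) (Var var_a)) = delta M q a"
    "exp_val enc m2 (in_delta (Var var_r) (Var var_a)) = delta M r a"
    using at less tab tabs by (simp_all add: exp_val_in_delta m1_def m2_def)
  then have m'_eq: "m' = result enc (block (map edge_prog tr)) m3"
    by (simp add: m' letter_prog_def m1_def m2_def m3_def)
  let ?I = "\<lambda>i m'. graph_mem (es @ map (edge p q r a) (take i tr)) m' \<and> agree link_frame m3 m'"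
  have "?I (length (map edge_prog tr)) m'"
    unfolding m'_eq
  proof (rule result_block_induct)
    have "graph_mem es m3" by (rule graph_mem_agree[OF g agr(3)]) auto
    then show "?I 0 m3" by (simp add: agree_refl)
  next
    fix i m4 assume i: "i < length (map edge_prog tr)" and I: "?I i m4"
    then have tab4: "tables m4" by (intro tables_agree[OF tabs(3), of link_frame]) auto
    have keep: "m4 (addr 0 v) = m3 (addr 0 v)" if "v \<in> {var_p, var_q, var_r, var_pa, var_qa, var_ra}" for v
      by (rule agreeD[of link_frame]) (use I that in auto)
    have loc: "located p q r m4" using at by (simp add: keep m3_def m2_def m1_def)
    have "m4 (addr 0 var_pa) = delta M p a" "m4 (addr 0 var_qa) = delta M q a"
      "m4 (addr 0 var_ra) = delta M r a" by (simp_all add: keep m3_def m2_def m1_def)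
    from edge_prog_correct[OF conjunct1[OF I] tab4 loc less _ this refl, of "tr ! i"] i
    have s: "graph_mem ((es @ map (edge p q r a) (take i tr)) @ [edge p q r a (tr ! i)])
        (result enc (edge_prog (tr ! i)) m4)"
      "agree link_frame m4 (result enc (edge_prog (tr ! i)) m4)" by simp_all
    from agree_trans[OF conjunct2[OF I] s(2)]
    have "agree link_frame m3 (result enc (edge_prog (tr ! i)) m4)" unfolding Un_absorb .
    with s(1) i show "?I (Suc i) (result enc (map edge_prog tr ! i) m4)"
      by (simp add: take_Suc_conv_app_nth)
  qed
  then have "graph_mem (es @ map (edge p q r a) tr) m'" "agree link_frame m3 m'" by simp_all
  moreover have "agree letter_frame m m'"
    using agree_trans[OF agr(3) calculation(2)] unfolding Un_commute[of ?U] .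
  ultimately show ?thesis by blast
qed

text \<open>The sources numbered from \<open>5 * L\<close> to \<open>5 * L + 4\<close> are exactly
  the vertices over the triple \<open>(p, q, r)\<close>.\<close>

lemma edges_triple:
  assumes L: "L = p * n * n + q * n + r" and less: "p < n" "q < n" "r < n"
  shows "{e \<in> edges. fst e < 5 * Suc L} = {e \<in> edges. fst e < 5 * L} \<union>
    {edge p q r a ij | a ij. a < k \<and> ij \<in> set tr}" (is "?A = ?B \<union> ?C")
proof (intro subset_antisym subsetI)
  fix e assume e: "e \<in> ?A"
  show "e \<in> ?B \<union> ?C"
  proof (cases "fst e < 5 * L")
    case False
    from e obtain p' q' r' a i j where *: "p' < n" "q' < n" "r' < n" "a < k" "(i, j) \<in> set tr"
      "e = edge p' q' r' a (i, j)" unfolding edges_def by auto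
    have i: "i < 5" using tr_less[OF *(5)] by simp
    \<comment> \<open>The remainder is the mode digit, so injectivity of the numbering
      applies.\<close>
    define t where "t = fst e - 5 * L"
    have t: "t < 5" "fst e = vertex n t p q r" using e False by (auto simp: t_def vertex_def L)
    have "fst e = vertex n i p' q' r'" by (simp add: *(6) edge_def)
    with t have "vertex n t p q r = vertex n i p' q' r'" by simp
    then have "p' = p" "q' = q" "r' = r"
      using vertex_inject[OF t(1) i less(2,3) *(2,3)] by auto
    with * show ?thesis by blast
  qed (use e in auto)
next
  fix e assume "e \<in> ?B \<union> ?C"
  then show "e \<in> ?A"
  proof
    assume "e \<in> ?C"
    then obtain a i j where *: "a < k" "(i, j) \<in> set tr" "e = edge p q r a (i, j)" by auto
    have "fst e < 5 * Suc L" using tr_less[OF *(2)] by (simp add: *(3) edge_def vertex_def L)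
    moreover have "e \<in> edges" using * less unfolding edges_def by blast
    ultimately show ?thesis by simp
  qed auto
qed

lemma runs_triple_prog:
  assumes b: "built L m" and loc: "located p q r m" and less: "p < n" "q < n" "r < n"
    and L: "L = p * n * n + q * n + r"
  shows "runs enc (triple_prog tr) m (triple_time k tr) (\<lambda>m'. built (Suc L) m' \<and> located p q r m')"
proof -
  let ?U = "{arr_coreach, arr_stack} \<times> UNIV \<union> {0} \<times> {var_top, var_v}"
  from b obtain es where tab: "tables m" and cur: "m (addr 0 var_cur) = 0"
    and mk: "marked (5 * L) m" and g: "graph_mem es m"
    and es: "set es = {e \<in> edges. fst e < 5 * L}" "length es = L * (k * length tr)"
    by (auto simp: built_def)
  let ?Q = "\<lambda>m'. tables m' \<and> m' (addr 0 var_cur) = 0 \<and> marked (5 * Suc L) m' \<and> graph_mem es m' \<and>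
    located p q r m'"
  have marks: "runs enc (block (map mark_prog [0..<5])) m (max_cost (block (map mark_prog [0..<5]))) ?Q"
  proof (rule runs_loop_free)
    show "loop_free (block (map mark_prog [0..<5]))" by (rule loop_free_block) auto
    let ?m = "result enc (block (map mark_prog [0..<5])) m"
    have *: "marked (5 * Suc L) ?m" "agree ?U m ?m"
      using marks_correct[OF tab loc less L mk refl] by auto
    have "?m (addr 0 v) = m (addr 0 v)" if "v \<in> {var_p, var_q, var_r, var_cur}" for v
      by (rule agreeD[OF *(2)]) (use that in auto)
    moreover have "tables ?m" by (rule tables_agree[OF tab *(2)]) auto
    moreover have "graph_mem es ?m" by (rule graph_mem_agree[OF g *(2)]) auto
    ultimately show "?Q ?m" using *(1) loc cur by simp
  qed
  have letters: "runs enc (For var_a in_k (letter_prog tr)) m1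
      (loop_time var_a in_k k (max_cost (letter_prog tr))) (\<lambda>m'. built (Suc L) m' \<and> located p q r m')"
    if Q: "?Q m1" for m1
  proof -
    let ?I = "\<lambda>a m'. tables m' \<and> m' (addr 0 var_cur) = 0 \<and> marked (5 * Suc L) m' \<and>
      located p q r m' \<and> m' (addr 0 var_a) = a \<and>
      (\<exists>es'. graph_mem (es @ es') m' \<and> set es' = {edge p q r b ij | b ij. b < a \<and> ij \<in> set tr} \<and>
         length es' = a * length tr)"
    have upd: "?I a (m'(addr 0 var_a := a))"
      if "tables m'" "m' (addr 0 var_cur) = 0" "marked (5 * Suc L) m'" "located p q r m'"
        "graph_mem (es @ es') m'" "set es' = {edge p q r b ij | b ij. b < a \<and> ij \<in> set tr}"
        "length es' = a * length tr" for a m' es'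
    proof -
      have agr: "agree {(0, var_a)} m' (m'(addr 0 var_a := a))" by (auto simp: agree_def)
      have "tables (m'(addr 0 var_a := a))" by (rule tables_agree[OF that(1) agr]) auto
      moreover have "marked (5 * Suc L) (m'(addr 0 var_a := a))"
        by (rule marked_agree[OF that(3) agr]) auto
      moreover have "graph_mem (es @ es') (m'(addr 0 var_a := a))"
        by (rule graph_mem_agree[OF that(5) agr]) auto
      ultimately show ?thesis using that(2,4,6,7) by (intro conjI exI[of _ es']) simp_all
    qed
    have "runs enc (For var_a in_k (letter_prog tr)) m1
        (loop_time var_a in_k k (max_cost (letter_prog tr))) (?I k)"
    proof (rule runs_loop[where I = ?I])
      show "?I 0 (m1(addr 0 var_a := 0))" using Q by (intro upd[of _ "[]"]) auto
      fix a m2 assume I: "?I a m2"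
      then show "m2 (addr 0 var_a) = a \<and> exp_val enc m2 in_k = k" by simp
      assume a: "a < k"
      from I obtain es' where tab2: "tables m2" and loc2: "located p q r m2" "m2 (addr 0 var_a) = a"
        and mk2: "marked (5 * Suc L) m2" and g2: "graph_mem (es @ es') m2"
        and es': "set es' = {edge p q r b ij | b ij. b < a \<and> ij \<in> set tr}" "length es' = a * length tr"
        by blast
      show "runs enc (letter_prog tr) m2 (max_cost (letter_prog tr))
          (\<lambda>m'. m' (addr 0 var_a) = a \<and> ?I (Suc a) (m'(addr 0 var_a := Suc a)))"
      proof (rule runs_loop_free[OF loop_free_letter_prog])
        let ?m = "result enc (letter_prog tr) m2"
        have *: "graph_mem ((es @ es') @ map (edge p q r a) tr) ?m" "agree letter_frame m2 ?m"
          using letter_prog_correct[OF g2 tab2 loc2 less a refl] by auto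
        have keep: "?m (addr 0 v) = m2 (addr 0 v)" if "v \<in> {var_p, var_q, var_r, var_a, var_cur}" for v
          by (rule agreeD[OF *(2)]) (use that in auto)
        have "tables ?m" by (rule tables_agree[OF tab2 *(2)]) auto
        moreover have "marked (5 * Suc L) ?m" by (rule marked_agree[OF mk2 *(2)]) auto
        moreover have "graph_mem (es @ (es' @ map (edge p q r a) tr)) ?m" using *(1) by simp
        moreover have "set (es' @ map (edge p q r a) tr) =
            {edge p q r b ij | b ij. b < Suc a \<and> ij \<in> set tr}"
          using es'(1) by (auto simp: less_Suc_eq)
        moreover have "length (es' @ map (edge p q r a) tr) = Suc a * length tr" using es'(2) by simp
        moreover have "located p q r ?m" "?m (addr 0 var_cur) = 0" using I by (simp_all add: keep)
        ultimately have "?I (Suc a) (?m(addr 0 var_a := Suc a))" by (intro upd)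
        then show "?m (addr 0 var_a) = a \<and> ?I (Suc a) (?m(addr 0 var_a := Suc a))"
          using loc2(2) keep[of var_a] by simp
      qed
    qed
    then show "runs enc (For var_a in_k (letter_prog tr)) m1
        (loop_time var_a in_k k (max_cost (letter_prog tr))) (\<lambda>m'. built (Suc L) m' \<and> located p q r m')"
    proof (rule runs_mono)
      fix m' assume "?I k m'"
      then obtain es' where *: "tables m'" "m' (addr 0 var_cur) = 0" "marked (5 * Suc L) m'"
        "located p q r m'" "graph_mem (es @ es') m'"
        "set es' = {edge p q r b ij | b ij. b < k \<and> ij \<in> set tr}" "length es' = k * length tr" by blast
      have "set (es @ es') = {e \<in> edges. fst e < 5 * Suc L}"
        using es(1) *(6) edges_triple[OF L less] by simp
      moreover have "length (es @ es') = Suc L * (k * length tr)" using es(2) *(7) by simp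
      ultimately show "built (Suc L) m' \<and> located p q r m'"
        using * unfolding built_def by blast
    qed simp
  qed
  show ?thesis
    unfolding triple_prog_def triple_time_def using marks letters by (rule runs_Seq)
qed

text \<open>The nested loops visit the triples in lexicographic order; the end of an inner loop is a
  carry, as \<open>q * n + n = Suc q * n\<close>.\<close>

lemma runs_build_prog:
  assumes b: "built 0 m"
  shows "runs enc (build_prog tr) m (build_time n k tr) (built (n * n * n))"
proof -
  have row: "runs enc (For var_r in_n (triple_prog tr)) m (loop_time var_r in_n n (triple_time k tr))
      (\<lambda>m'. built (p * n * n + Suc q * n) m' \<and> m' (addr 0 var_p) = p \<and> m' (addr 0 var_q) = q)"
    if pq: "p < n" "q < n" and b: "built (p * n * n + q * n) m"
      and loc: "m (addr 0 var_p) = p" "m (addr 0 var_q) = q" for p q m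
  proof -
    let ?I = "\<lambda>r m. built (p * n * n + q * n + r) m \<and> located p q r m"
    have "runs enc (For var_r in_n (triple_prog tr)) m (loop_time var_r in_n n (triple_time k tr)) (?I n)"
    proof (rule runs_loop[where I = ?I])
      show "?I 0 (m(addr 0 var_r := 0))" using b loc built_upd by simp
      fix r m assume I: "?I r m"
      then show "m (addr 0 var_r) = r \<and> exp_val enc m in_n = n" by simp
      assume "r < n"
      with I pq have "runs enc (triple_prog tr) m (triple_time k tr)
          (\<lambda>m'. built (Suc (p * n * n + q * n + r)) m' \<and> located p q r m')"
        by (intro runs_triple_prog) auto
      then show "runs enc (triple_prog tr) m (triple_time k tr)
          (\<lambda>m'. m' (addr 0 var_r) = r \<and> ?I (Suc r) (m'(addr 0 var_r := Suc r)))"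
        by (rule runs_mono) (simp_all add: built_upd)
    qed
    then show ?thesis by (rule runs_mono) (simp_all add: ac_simps)
  qed
  have plane: "runs enc (For var_q in_n (For var_r in_n (triple_prog tr))) m
      (loop_time var_q in_n n (loop_time var_r in_n n (triple_time k tr)))
      (\<lambda>m'. built (Suc p * n * n) m' \<and> m' (addr 0 var_p) = p)"
    if p: "p < n" and b: "built (p * n * n) m" and loc: "m (addr 0 var_p) = p" for p m
  proof -
    let ?I = "\<lambda>q m. built (p * n * n + q * n) m \<and> m (addr 0 var_p) = p \<and> m (addr 0 var_q) = q"
    have "runs enc (For var_q in_n (For var_r in_n (triple_prog tr))) m
        (loop_time var_q in_n n (loop_time var_r in_n n (triple_time k tr))) (?I n)"
    proof (rule runs_loop[where I = ?I])
      show "?I 0 (m(addr 0 var_q := 0))" using b loc built_upd by simp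
      fix q m assume I: "?I q m"
      then show "m (addr 0 var_q) = q \<and> exp_val enc m in_n = n" by simp
      assume "q < n"
      with I p have "runs enc (For var_r in_n (triple_prog tr)) m
          (loop_time var_r in_n n (triple_time k tr))
          (\<lambda>m'. built (p * n * n + Suc q * n) m' \<and> m' (addr 0 var_p) = p \<and> m' (addr 0 var_q) = q)"
        by (intro row) auto
      then show "runs enc (For var_r in_n (triple_prog tr)) m
          (loop_time var_r in_n n (triple_time k tr))
          (\<lambda>m'. m' (addr 0 var_q) = q \<and> ?I (Suc q) (m'(addr 0 var_q := Suc q)))"
        by (rule runs_mono) (auto simp: built_upd simp del: mult_Suc)
    qed
    then show ?thesis by (rule runs_mono) (simp_all add: algebra_simps)
  qed
  let ?I = "\<lambda>p m. built (p * n * n) m \<and> m (addr 0 var_p) = p"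
  have "runs enc (build_prog tr) m (build_time n k tr) (?I n)"
    unfolding build_prog_def build_time_def
  proof (rule runs_loop[where I = ?I])
    show "?I 0 (m(addr 0 var_p := 0))" using b built_upd by simp
    fix p m assume I: "?I p m"
    then show "m (addr 0 var_p) = p \<and> exp_val enc m in_n = n" by simp
    assume "p < n"
    with I have "runs enc (For var_q in_n (For var_r in_n (triple_prog tr))) m
      (loop_time var_q in_n n (loop_time var_r in_n n (triple_time k tr)))
      (\<lambda>m'. built (Suc p * n * n) m' \<and> m' (addr 0 var_p) = p)" by (intro plane) auto
    then show "runs enc (For var_q in_n (For var_r in_n (triple_prog tr))) m
      (loop_time var_q in_n n (loop_time var_r in_n n (triple_time k tr)))
      (\<lambda>m'. m' (addr 0 var_p) = p \<and> ?I (Suc p) (m'(addr 0 var_p := Suc p)))"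
      by (rule runs_mono) (auto simp: built_upd simp del: mult_Suc)
  qed
  then show ?thesis by (rule runs_mono) simp_all
qed

text \<open>Zeroed memory already represents an empty stack and null list heads.\<close>

lemma built_0:
  assumes "tables m" "agree ({arr_n, arr_nn, arr_k} \<times> UNIV \<union> {(0, var_p)}) (\<lambda>_. 0) m"
  shows "built 0 m"
proof -
  have zero: "m (addr j i) = 0" if "j < 16" "j \<notin> {arr_n, arr_nn, arr_k}" "(j, i) \<noteq> (0, var_p)" for j i
    using agreeD[OF assms(2) that(1), of i] that by auto
  have "stack_is [] m" by (simp add: stack_is_def zero)
  then have "marked 0 m" by (simp add: marked_def)
  moreover have "graph_mem [] m" by (simp add: graph_mem_def linked_def zero edge_count_def)
  ultimately show ?thesis using assms(1) by (auto simp: built_def zero)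
qed

section \<open>Second peeling and the complete program\<close>

lemma runs_restart_prog:
  assumes tab: "tables m" and top: "m (addr 0 var_top) = 0"
    and co: "\<And>v. v < verts \<Longrightarrow> m (addr arr_coreach v) = 0 \<longleftrightarrow> B v"
    and deg: "\<And>v. v < verts \<Longrightarrow> m (addr arr_degree v) = d v"
    and c: "\<And>v. c v = (if B v then d v else 0)"
  shows "runs enc restart_prog m
    (loop_time var_v (times5 (Load arr_nn in_n)) verts (max_cost restart_step))
    (\<lambda>m'. agree ({arr_degree, arr_stack} \<times> UNIV \<union> {0} \<times> {var_top, var_v}) m m' \<and>
       (\<forall>v<verts. m' (addr arr_degree v) = c v) \<and>
       (\<exists>stk. stack_is stk m' \<and> distinct stk \<and> set stk = {v. v < verts \<and> c v = 0}))"
proof -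
  let ?U = "{arr_degree, arr_stack} \<times> UNIV \<union> {0} \<times> {var_top, var_v}"
  let ?I = "\<lambda>i m'. m' (addr 0 var_v) = i \<and> agree ?U m m' \<and>
    (\<forall>v<verts. m' (addr arr_degree v) = (if v < i then c v else d v)) \<and>
    (\<exists>stk. stack_is stk m' \<and> distinct stk \<and> set stk = {v. v < i \<and> c v = 0})"
  have "runs enc restart_prog m
      (loop_time var_v (times5 (Load arr_nn in_n)) verts (max_cost restart_step)) (?I verts)"
    unfolding restart_prog_def
  proof (rule runs_loop[where I = ?I])
    have "stack_is [] (m(addr 0 var_v := 0))" using top by (simp add: stack_is_def)
    then show "?I 0 (m(addr 0 var_v := 0))" using deg by (auto simp: agree_def)
    fix i m1 assume I: "?I i m1"
    have "tables m1" by (rule tables_agree[OF tab, of ?U]) (use I in auto)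
    then show "m1 (addr 0 var_v) = i \<and> exp_val enc m1 (times5 (Load arr_nn in_n)) = verts"
      using I by (simp add: tables_def)
    assume i: "i < verts"
    have co1: "m1 (addr arr_coreach v) = m (addr arr_coreach v)" for v
      using I by (intro agreeD[of ?U]) auto
    from I obtain stk where stk: "stack_is stk m1" "distinct stk" "set stk = {v. v < i \<and> c v = 0}" by blast
    let ?m = "if c i = 0 then result enc push_prog (m1(addr arr_degree i := 0)) else m1"
    have m': "result enc restart_step m1 = ?m"
      using I i co[OF i] c[of i] by (simp add: restart_step_def co1)
    have "stack_is stk (m1(addr arr_degree i := 0))" using stk(1) by (simp add: stack_is_def)
    from stack_is_push[OF this, of enc] I
    have push: "stack_is (stk @ [i]) (result enc push_prog (m1(addr arr_degree i := 0)))" by simp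
    have "stack_is (if c i = 0 then stk @ [i] else stk) ?m" using push stk(1) by simp
    then have "stack_is (if c i = 0 then stk @ [i] else stk) (?m(addr 0 var_v := Suc i))"
      by (simp add: stack_is_def)
    moreover have "distinct (if c i = 0 then stk @ [i] else stk)" using stk by simp
    moreover have "set (if c i = 0 then stk @ [i] else stk) = {v. v < Suc i \<and> c v = 0}"
    proof (rule set_eqI)
      fix v
      show "v \<in> set (if c i = 0 then stk @ [i] else stk) \<longleftrightarrow> v \<in> {v. v < Suc i \<and> c v = 0}"
        by (cases "v = i"; cases "c i = 0") (simp_all add: stk(3) less_Suc_eq)
    qed
    moreover have "agree ?U m (?m(addr 0 var_v := Suc i))"
    proof -
      have "agree ?U m1 (?m(addr 0 var_v := Suc i))" by (auto simp: agree_def result_push_prog)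
      with I agree_trans[of ?U m m1 ?U] show ?thesis unfolding Un_absorb by blast
    qed
    moreover have "\<forall>v<verts. (?m(addr 0 var_v := Suc i)) (addr arr_degree v) = (if v < Suc i then c v else d v)"
    proof (intro allI impI)
      fix v assume "v < verts"
      then have "m1 (addr arr_degree v) = (if v < i then c v else d v)" using I by blast
      moreover have "c i \<noteq> 0 \<Longrightarrow> c i = d i" using c[of i] by (simp split: if_splits)
      ultimately show "(?m(addr 0 var_v := Suc i)) (addr arr_degree v) = (if v < Suc i then c v else d v)"
        by (cases "v = i") (simp_all add: result_push_prog)
    qed
    moreover have "?m (addr 0 var_v) = i" using I by (simp add: result_push_prog)
    moreover have "(?m(addr 0 var_v := Suc i)) (addr 0 var_v) = Suc i" by simp
    ultimately have "?m (addr 0 var_v) = i \<and> ?I (Suc i) (?m(addr 0 var_v := Suc i))" by blast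
    then have post: "result enc restart_step m1 (addr 0 var_v) = i \<and>
        ?I (Suc i) ((result enc restart_step m1)(addr 0 var_v := Suc i))" unfolding m' .
    show "runs enc restart_step m1 (max_cost restart_step)
        (\<lambda>m'. m' (addr 0 var_v) = i \<and> ?I (Suc i) (m'(addr 0 var_v := Suc i)))"
    proof (rule runs_loop_free)
      show "loop_free restart_step" by (simp add: restart_step_def)
    qed (fact post)
  qed
  then show ?thesis by (rule runs_mono) auto
qed

text \<open>The second peeling reuses the lists unchanged; between the runs only counters and stack
  are reset.\<close>

lemma runs_decide_prog:
  assumes R: "\<And>u v w. R u v \<and> R v w \<longleftrightarrow> tracks (set tr) s u v w"
  shows "runs enc (decide_prog s tr) (\<lambda>_. 0) (decide_time s tr k n)
    (\<lambda>m. m 0 = (if almost_convex (alphabet M) R (lang M) then 1 else 0))"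
  unfolding decide_prog_def decide_time_def
proof (rule runs_Seq[OF runs_tables_prog], rule runs_Seq[OF runs_build_prog])
  fix m assume "tables m \<and> agree ({arr_n, arr_nn, arr_k} \<times> UNIV \<union> {(0, var_p)}) (\<lambda>_. 0) m"
  then show "built 0 m" by (intro built_0) auto
next
  let ?lengths = "accepted_lengths edges accepting"
  fix m assume "built (n * n * n) m"
  then obtain es stk where tab: "tables m" and cur: "m (addr 0 var_cur) = 0" and g: "graph_mem es m"
    and es: "set es = {e \<in> edges. fst e < verts}" "length es = n * n * n * (k * length tr)"
    and stk: "stack_is stk m" "distinct stk" "set stk = {v \<in> accepting. v < verts}"
    and mk: "\<And>v. v < verts \<Longrightarrow> m (addr arr_coreach v) = (if v \<in> accepting then 0 else 1)"
    unfolding built_def marked_def by blast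
  have lnk: "linked es verts m" and sub: "set es \<subseteq> {..<verts} \<times> {..<verts}"
    and deg: "\<And>v. v < verts \<Longrightarrow> m (addr arr_degree v) = edge_count es v UNIV"
    using g by (auto simp: graph_mem_def)
  have E: "set es = edges" using es(1) edges_bounded by auto
  have len: "length es + verts \<le> n * n * n * (k * length tr + 5)" by (simp add: es(2) algebra_simps)
  let ?c = "\<lambda>v. if ?lengths v = {} then 0 else edge_count es v UNIV"
  have zeros: "set stk = zeros verts (\<lambda>v. m (addr arr_coreach v))"
    unfolding stk(3) zeros_def using mk by (auto split: if_splits)
  show "runs enc (Seq (peel_prog arr_coreach) (Seq restart_prog (Seq (peel_prog arr_degree) (answer_prog s)))) m
     (peel_time arr_coreach (n * n * n * (k * length tr + 5)) +
     (loop_time var_v (times5 (Load arr_nn in_n)) verts (max_cost restart_step) +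
     (peel_time arr_degree (n * n * n * (k * length tr + 5)) + max_cost (answer_prog s))))
     (\<lambda>m. m 0 = (if almost_convex (alphabet M) R (lang M) then 1 else 0))"
  proof (rule runs_Seq[OF runs_peel_prog[OF stk(1,2) zeros cur lnk sub _ len]])
    fix m1 assume "least_closed es {..<verts} (\<lambda>v. m (addr arr_coreach v))
        (zeros verts (\<lambda>v. m1 (addr arr_coreach v))) \<and> agree (peel_frame arr_coreach) m m1 \<and>
        m1 (addr 0 var_top) = 0 \<and> m1 (addr 0 var_cur) = 0"
    then have lc: "least_closed es {..<verts} (\<lambda>v. m (addr arr_coreach v))
        (zeros verts (\<lambda>v. m1 (addr arr_coreach v)))" and agr: "agree (peel_frame arr_coreach) m m1"
      and top1: "m1 (addr 0 var_top) = 0" and cur1: "m1 (addr 0 var_cur) = 0" by auto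
    have "least_closed es {..<verts} (\<lambda>v. if v \<in> accepting then 0 else 1)
        (zeros verts (\<lambda>v. m1 (addr arr_coreach v)))"
      using lc least_closed_cong[of "{..<verts}" "\<lambda>v. m (addr arr_coreach v)"
          "\<lambda>v. if v \<in> accepting then 0 else 1"] mk by simp
    from least_closed_coreachable[OF this sub]
    have co1: "m1 (addr arr_coreach v) = 0 \<longleftrightarrow> ?lengths v \<noteq> {}" if "v < verts" for v
      using that by (simp add: zeros_def E)
    have tab1: "tables m1" by (rule tables_agree[OF tab agr]) auto
    have lnk1: "linked es verts m1" by (rule linked_agree[OF lnk agr]) auto
    have deg1: "m1 (addr arr_degree v) = edge_count es v UNIV" if "v < verts" for v
      using deg[OF that] agreeD[OF agr, of arr_degree v] by simp
    have c: "?c v = (if ?lengths v \<noteq> {} then edge_count es v UNIV else 0)" for v by simp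
    show "runs enc (Seq restart_prog (Seq (peel_prog arr_degree) (answer_prog s))) m1
       (loop_time var_v (times5 (Load arr_nn in_n)) verts (max_cost restart_step) +
       (peel_time arr_degree (n * n * n * (k * length tr + 5)) + max_cost (answer_prog s)))
       (\<lambda>m. m 0 = (if almost_convex (alphabet M) R (lang M) then 1 else 0))"
    proof (rule runs_Seq[OF runs_restart_prog[OF tab1 top1 co1 deg1 c]])
      let ?U = "{arr_degree, arr_stack} \<times> UNIV \<union> {0} \<times> {var_top, var_v}"
      fix m2 assume "agree ?U m1 m2 \<and> (\<forall>v<verts. m2 (addr arr_degree v) = ?c v) \<and>
        (\<exists>stk. stack_is stk m2 \<and> distinct stk \<and> set stk = {v. v < verts \<and> ?c v = 0})"
      then obtain stk2 where agr2: "agree ?U m1 m2"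
        and deg2: "\<And>v. v < verts \<Longrightarrow> m2 (addr arr_degree v) = ?c v"
        and stk2: "stack_is stk2 m2" "distinct stk2" "set stk2 = {v. v < verts \<and> ?c v = 0}" by blast
      have zeros2: "set stk2 = zeros verts (\<lambda>v. m2 (addr arr_degree v))"
        unfolding stk2(3) zeros_def by (intro Collect_cong conj_cong refl) (simp add: deg2)
      have cur2: "m2 (addr 0 var_cur) = 0" using cur1 agreeD[OF agr2, of 0 var_cur] by simp
      have lnk2: "linked es verts m2" by (rule linked_agree[OF lnk1 agr2]) auto
      show "runs enc (Seq (peel_prog arr_degree) (answer_prog s)) m2
         (peel_time arr_degree (n * n * n * (k * length tr + 5)) + max_cost (answer_prog s))
         (\<lambda>m. m 0 = (if almost_convex (alphabet M) R (lang M) then 1 else 0))"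
      proof (rule runs_Seq[OF runs_peel_prog[OF stk2(1,2) zeros2 cur2 lnk2 sub _ len]])
        fix m3 assume "least_closed es {..<verts} (\<lambda>v. m2 (addr arr_degree v))
          (zeros verts (\<lambda>v. m3 (addr arr_degree v))) \<and> agree (peel_frame arr_degree) m2 m3 \<and>
          m3 (addr 0 var_top) = 0 \<and> m3 (addr 0 var_cur) = 0"
        then have lc3: "least_closed es {..<verts} (\<lambda>v. m2 (addr arr_degree v))
            (zeros verts (\<lambda>v. m3 (addr arr_degree v)))"
          and agr3: "agree (peel_frame arr_degree) m2 m3" by auto
        have "least_closed es {..<verts} ?c (zeros verts (\<lambda>v. m3 (addr arr_degree v)))"
          using lc3 least_closed_cong[of "{..<verts}" "\<lambda>v. m2 (addr arr_degree v)" ?c] deg2 by simp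
        from least_closed_finite_lengths[OF this[folded E] sub]
        have fin: "m3 (addr arr_degree start) = 0 \<longleftrightarrow> finite (?lengths start)"
          using start_bounded by (simp add: zeros_def E)
        have tab2: "tables m2" by (rule tables_agree[OF tab1 agr2]) auto
        have tab3: "tables m3" by (rule tables_agree[OF tab2 agr3]) auto
        \<comment> \<open>The restart and the second run do not write to the first counter array, so
          both answers are available at the end.\<close>
        have "m3 (addr arr_coreach start) = m1 (addr arr_coreach start)"
          using agreeD[OF agr2, of arr_coreach start] agreeD[OF agr3, of arr_coreach start] by simp
        then have ne: "m3 (addr arr_coreach start) = 0 \<longleftrightarrow> ?lengths start \<noteq> {}"
          using co1[OF start_bounded] by simp
        have "exp_val enc m3 (vertex_exp s in_initial in_initial in_initial) = start"
          using initial_less by (simp add: exp_val_vertex_exp[OF tab3] start_def)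
        then have "result enc (answer_prog s) m3 (addr 0 0) =
            1 - (m3 (addr arr_coreach start) + m3 (addr arr_degree start))"
          by (simp add: answer_prog_def)
        also have "\<dots> = (if almost_convex (alphabet M) R (lang M) then 1 else 0)"
          using ne fin by (auto simp: almost_convex_iff[OF R])
        finally have "result enc (answer_prog s) m3 0 =
            (if almost_convex (alphabet M) R (lang M) then 1 else 0)" by (simp add: addr_def)
        then show "runs enc (answer_prog s) m3 (max_cost (answer_prog s))
            (\<lambda>m. m 0 = (if almost_convex (alphabet M) R (lang M) then 1 else 0))"
          by (intro runs_loop_free) (simp add: answer_prog_def)
      qed simp
    qed
  qed simp
qed

end

theorem theorem4:
  fixes R :: "nat list \<Rightarrow> nat list \<Rightarrow> bool"
  assumes "R \<in> {prefix, suffix, sublist, subseq}"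
  shows "\<exists>P :: ram_prog. \<forall>k :: nat. \<exists>T :: nat \<Rightarrow> nat.
    (\<lambda>n. real (T n)) \<in> O(\<lambda>n. real n ^ 3) \<and>
    (\<forall>(n :: nat) (M :: (nat, nat) dfa).
       is_dfa M \<and> states M = {..<n} \<and> alphabet M = {..<k} \<longrightarrow>
       answers_within P (encode_dfa n k M) (almost_convex (alphabet M) R (lang M)) (T n))"
proof -
  obtain s tr where s: "s < 5" and tr: "\<And>i j. (i, j) \<in> set tr \<Longrightarrow> i < 5 \<and> j < 5"
    and R: "\<And>u v w. R u v \<and> R v w \<longleftrightarrow> tracks (set tr) s u v w"
    using order_tracks[OF assms] by metis
  show ?thesis
  \<comment> \<open>The program depends only on the order; the constant is chosen after
    \<open>k\<close>.\<close>
  proof (intro exI[of _ "decide_prog s tr"] allI)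
    fix k
    obtain C where C: "\<And>n. 1 \<le> n \<Longrightarrow> decide_time s tr k n \<le> C * n ^ 3"
      using decide_time_le by blast
    show "\<exists>T :: nat \<Rightarrow> nat. (\<lambda>n. real (T n)) \<in> O(\<lambda>n. real n ^ 3) \<and>
      (\<forall>(n :: nat) (M :: (nat, nat) dfa).
         is_dfa M \<and> states M = {..<n} \<and> alphabet M = {..<k} \<longrightarrow>
         answers_within (decide_prog s tr) (encode_dfa n k M)
           (almost_convex (alphabet M) R (lang M)) (T n))"
    proof (intro exI[of _ "\<lambda>n. C * n ^ 3"] conjI allI impI)
      show "(\<lambda>n. real (C * n ^ 3)) \<in> O(\<lambda>n. real n ^ 3)" by simp
      fix n and M :: "(nat, nat) dfa"
      assume M: "is_dfa M \<and> states M = {..<n} \<and> alphabet M = {..<k}"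
      then interpret product_graph n k M s tr by unfold_locales (use s tr in auto)
      \<comment> \<open>The initial state is below \<open>n\<close>, so \<open>n \<ge> 1\<close>, as
        the estimate requires.\<close>
      have "decide_time s tr k n \<le> C * n ^ 3" using initial_less by (intro C) simp
      with runs_decide_prog[OF R] show "answers_within (decide_prog s tr) enc
          (almost_convex (alphabet M) R (lang M)) (C * n ^ 3)"
        unfolding runs_def answers_within_def by (meson le_trans)
    qed
  qed
qed

end
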